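(* Let $P(\lambda)=P_0+P_1\lambda+\cdots+P_d\lambda^d\in\mathbb{C}[\lambda]^{m\times n}$ be a polynomial matrix of degree $d>1$ (so $P_d\neq 0$). Let $T$ be the block Hankel matrix and $L_s(\lambda)=\begin{bmatrix}A_s(\lambda)&-B_s(\lambda)\\ C_s(\lambda)&D_s(\lambda)\end{bmatrix}$ the pencil associated with $P(\lambda)$ defined in the context, and let $r:=\operatorname{rank}T$. Let $U=[\,U_1\ \ U_2\,]\in\mathbb{C}^{m(d-1)\times m(d-1)}$ and $V=[\,V_1\ \ V_2\,]\in\mathbb{C}^{n(d-1)\times n(d-1)}$ be unitary matrices, where $U_2$ and $V_2$ have $r$ columns, such that $$U^*TV=\begin{bmatrix}0&0\\0&U_2^*TV_2\end{bmatrix}=:\begin{bmatrix}0&0\\0&\widehat T\end{bmatrix},$$ where $\widehat T$ is $r\times r$ and invertible. Then the pencil $\operatorname{diag}(U^*,I_m)\,L_s(\lambda)\,\operatorname{diag}(V,I_n)$ has the "compressed" form $$\left[\begin{array}{c|c}U^*A_s(\lambda)V&-U^*B_s(\lambda)\\ \hline C_s(\lambda)V&D_s(\lambda)\end{array}\right]=\left[\begin{array}{cc|c}0&0&0\\0&\widehat A_s(\lambda)&-\widehat B_s(\lambda)\\ \hline 0&\widehat C_s(\lambda)&\widehat D_s(\lambda)\end{array}\right],$$ where $\widehat A_s(\lambda)\in\mathbb{C}[\lambda]^{r\times r}$ (so that the first $m(d-1)-r$ rows and the first $n(d-1)-r$ columns are zero), and $$\widehat L_s(\lambda):=\left[\begin{array}{c|c}\widehat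 A_s(\lambda)&-\widehat B_s(\lambda)\\ \hline \widehat C_s(\lambda)&\widehat D_s(\lambda)\end{array}\right]$$ is a strongly minimal linearization of $P(\lambda)$, where $\widehat A_s(\lambda)$ is regular. In particular, $P(\lambda)=\widehat D_s(\lambda)+\widehat C_s(\lambda)\widehat A_s(\lambda)^{-1}\widehat B_s(\lambda)$.
   Context: **Block Hankel matrix and pencil of a polynomial matrix.** For $P(\lambda)=P_0+P_1\lambda+\cdots+P_d\lambda^d\in\mathbb{C}[\lambda]^{m\times n}$ with $d>1$, set $P_k:=0$ for $k>d$. * $T\in\mathbb{C}^{m(d-1)\times n(d-1)}$ is the $(d-1)\times(d-1)$ block matrix whose $(i,j)$ block ($1\le i,j\le d-1$) is $P_{2d-i-j}$, i.e. $$T=\begin{bmatrix}&&&P_d\\&&{\cdot}^{{\cdot}^{\cdot}}&P_{d-1}\\&P_d&{\cdot}^{{\cdot}^{\cdot}}&\vdots\\P_d&P_{d-1}&\cdots&P_2\end{bmatrix}.$$ * $L_s(\lambda)=\begin{bmatrix}A_s(\lambda)&-B_s(\lambda)\\C_s(\lambda)&D_s(\lambda)\end{bmatrix}\in\mathbb{C}[\lambda]^{md\times nd}$, where $A_s(\lambda)$ is the $(d-1)\times(d-1)$ block matrix with $(i,j)$ block $\lambda P_{2d+1-i-j}-P_{2d-i-j}$; $-B_s(\lambda)$ is the block column with blocks (top to bottom) $\lambda P_d,\lambda P_{d-1},\ldots,\lambda P_2$; $C_s(\lambda)$ is the block row with blocks (left to right) $\lambda P_d,\lambda P_{d-1},\ldots,\lambda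 P_2$; and $D_s(\lambda)=\lambda P_1+P_0$. **Strongly minimal linearization.** A square polynomial matrix is regular if its determinant is not identically zero. A linear polynomial system matrix is a block-partitioned pencil $$L(\lambda)=\begin{bmatrix}A(\lambda)&-B(\lambda)\\C(\lambda)&D(\lambda)\end{bmatrix}=\begin{bmatrix}\lambda A_1-A_0&-\lambda B_1+B_0\\ \lambda C_1-C_0&\lambda D_1-D_0\end{bmatrix}\in\mathbb{C}[\lambda]^{(p+m)\times(p+n)}$$ with $A(\lambda)\in\mathbb{C}[\lambda]^{p\times p}$ regular; its transfer function matrix is $D(\lambda)+C(\lambda)A(\lambda)^{-1}B(\lambda)$. It is strongly minimal if the pencils $[A(\lambda)\ \ -B(\lambda)]$ and $\begin{bmatrix}A(\lambda)\\C(\lambda)\end{bmatrix}$ have degree exactly 1 and no finite or infinite eigenvalues; that is, for every $\lambda_0\in\mathbb{C}$ the matrices $[A(\lambda_0)\ \ -B(\lambda_0)]$ and $\begin{bmatrix}A(\lambda_0)\\C(\lambda_0)\end{bmatrix}$ have rank $p$, and $[A_1\ \ -B_1]$ and $\begin{bmatrix}A_1\\C_1\end{bmatrix}$ have rank $p$. $L(\lambda)$ is a strongly minimal linearization of a rational matrix $R(\lambda)\in\mathbb{C}(\lambda)^{m\times n}$ if it is strongly minimal and its transfer function matrix is $R(\lambda)$. Here $^*$ denotes conjugate transpose. *)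

theory Defs
  imports
    "HOL.Complex"
    "HOL-Computational_Algebra.Normalized_Fraction"
    "Jordan_Normal_Form.DL_Rank"
    "Jordan_Normal_Form.Gauss_Jordan_Elimination"
    "Jordan_Normal_Form.Schur_Decomposition"
begin

text \<open>
  A polynomial matrix is a value of type \<^typ>\<open>complex poly mat\<close>; a rational matrix is a value of
  type \<^typ>\<open>complex poly fract mat\<close>.
\<close>

definition append_cols :: "'a :: zero mat \<Rightarrow> 'a mat \<Rightarrow> 'a mat" (infixr \<open>@\<^sub>c\<close> 65) where
  "A @\<^sub>c B = four_block_mat A B (0\<^sub>m 0 (dim_col A)) (0\<^sub>m 0 (dim_col B))"

text \<open>The \<open>k \<times> l\<close> block matrix with \<open>m \<times> n\<close> blocks; block indices start at 1.\<close>

definition blocks :: "nat \<Rightarrow> nat \<Rightarrow> nat \<Rightarrow> nat \<Rightarrow> (nat \<Rightarrow> nat \<Rightarrow> 'a mat) \<Rightarrow> 'a mat" where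
  "blocks k l m n F =
     mat (m * k) (n * l) (\<lambda>(i, j). F (i div m + 1) (j div n + 1) $$ (i mod m, j mod n))"

abbreviation diag2 :: "'a :: zero mat \<Rightarrow> 'a mat \<Rightarrow> 'a mat" where
  "diag2 A D \<equiv> four_block_mat A (0\<^sub>m (dim_row A) (dim_col D)) (0\<^sub>m (dim_row D) (dim_col A)) D"

definition unitary_mat :: "complex mat \<Rightarrow> bool" where
  "unitary_mat U \<longleftrightarrow> square_mat U \<and> mat_adjoint U * U = 1\<^sub>m (dim_row U)"

abbreviation mat_rank :: "'a :: field mat \<Rightarrow> nat" where
  "mat_rank A \<equiv> vec_space.rank (dim_row A) A"

definition pmat_coeff :: "complex poly mat \<Rightarrow> nat \<Rightarrow> complex mat" where
  "pmat_coeff P k = map_mat (\<lambda>p. coeff p k) P"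

definition pmat_eval :: "complex poly mat \<Rightarrow> complex \<Rightarrow> complex mat" where
  "pmat_eval P z = map_mat (\<lambda>p. poly p z) P"

text \<open>The zero matrix has degree 0, following \<^const>\<open>degree\<close>.\<close>

definition pmat_degree :: "complex poly mat \<Rightarrow> nat" where
  "pmat_degree P = Max (insert 0 (degree ` elements_mat P))"

definition const_pmat :: "complex mat \<Rightarrow> complex poly mat" where
  "const_pmat M = map_mat (\<lambda>c. [:c:]) M"

abbreviation rmat :: "complex poly mat \<Rightarrow> complex poly fract mat" where
  "rmat P \<equiv> map_mat to_fract P"

definition hankel_T :: "complex poly mat \<Rightarrow> complex mat" where
  "hankel_T P = (let d = pmat_degree P in
     blocks (d - 1) (d - 1) (dim_row P) (dim_col P) (\<lambda>i j. pmat_coeff P (2 * d - i - j)))"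

definition A_s :: "complex poly mat \<Rightarrow> complex poly mat" where
  "A_s P = (let d = pmat_degree P in
     blocks (d - 1) (d - 1) (dim_row P) (dim_col P)
       (\<lambda>i j. [:0, 1:] \<cdot>\<^sub>m const_pmat (pmat_coeff P (2 * d + 1 - i - j))
              - const_pmat (pmat_coeff P (2 * d - i - j))))"

definition B_s :: "complex poly mat \<Rightarrow> complex poly mat" where
  "B_s P = (let d = pmat_degree P in
     - blocks (d - 1) 1 (dim_row P) (dim_col P)
         (\<lambda>i j. [:0, 1:] \<cdot>\<^sub>m const_pmat (pmat_coeff P (d + 1 - i))))"

definition C_s :: "complex poly mat \<Rightarrow> complex poly mat" where
  "C_s P = (let d = pmat_degree P in
     blocks 1 (d - 1) (dim_row P) (dim_col P)
       (\<lambda>i j. [:0, 1:] \<cdot>\<^sub>m const_pmat (pmat_coeff P (d + 1 - j))))"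

definition D_s :: "complex poly mat \<Rightarrow> complex poly mat" where
  "D_s P = [:0, 1:] \<cdot>\<^sub>m const_pmat (pmat_coeff P 1) + const_pmat (pmat_coeff P 0)"

definition L_s :: "complex poly mat \<Rightarrow> complex poly mat" where
  "L_s P = four_block_mat (A_s P) (- B_s P) (C_s P) (D_s P)"

definition regular_pmat :: "complex poly mat \<Rightarrow> bool" where
  "regular_pmat A \<longleftrightarrow> square_mat A \<and> det A \<noteq> 0"

text \<open>
  A system matrix is represented by its four blocks \<open>A, B, C, D\<close>; the matrix itself is
  \<open>four_block_mat A (- B) C D\<close>.
\<close>

definition linear_system_matrix ::
  "complex poly mat \<Rightarrow> complex poly mat \<Rightarrow> complex poly mat \<Rightarrow> complex poly mat \<Rightarrow> bool" where
  "linear_system_matrix A B C D \<longleftrightarrow>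
     B \<in> carrier_mat (dim_row A) (dim_col D) \<and>
     C \<in> carrier_mat (dim_row D) (dim_col A) \<and>
     pmat_degree (four_block_mat A (- B) C D) \<le> 1 \<and>
     regular_pmat A"

definition transfer_function ::
  "complex poly mat \<Rightarrow> complex poly mat \<Rightarrow> complex poly mat \<Rightarrow> complex poly mat
     \<Rightarrow> complex poly fract mat" where
  "transfer_function A B C D = rmat D + rmat C * the (mat_inverse (rmat A)) * rmat B"

text \<open>
  For a pencil \<open>\<lambda> M\<^sub>1 + M\<^sub>0\<close> with \<open>p\<close> rows or \<open>p\<close> columns: degree exactly 1, no finite eigenvalues
  (full rank at every point) and no infinite eigenvalues (\<open>M\<^sub>1\<close> has full rank).
\<close>

definition deg1_no_eigenvalues :: "nat \<Rightarrow> complex poly mat \<Rightarrow> bool" where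
  "deg1_no_eigenvalues p M \<longleftrightarrow>
     pmat_degree M = 1 \<and>
     (\<forall>z. mat_rank (pmat_eval M z) = p) \<and>
     mat_rank (pmat_coeff M 1) = p"

definition strongly_minimal ::
  "complex poly mat \<Rightarrow> complex poly mat \<Rightarrow> complex poly mat \<Rightarrow> complex poly mat \<Rightarrow> bool" where
  "strongly_minimal A B C D \<longleftrightarrow>
     linear_system_matrix A B C D \<and>
     deg1_no_eigenvalues (dim_row A) (A @\<^sub>c (- B)) \<and>
     deg1_no_eigenvalues (dim_row A) (A @\<^sub>r C)"

definition strongly_minimal_linearization ::
  "complex poly mat \<Rightarrow> complex poly mat \<Rightarrow> complex poly mat \<Rightarrow> complex poly mat
     \<Rightarrow> complex poly fract mat \<Rightarrow> bool" where
  "strongly_minimal_linearization A B C D R \<longleftrightarrow>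
     strongly_minimal A B C D \<and> transfer_function A B C D = R"

end

theory Submission
  imports Defs "Subresultants.More_Homomorphisms"
begin

text \<open>
  Let \<open>N\<close> be the block shift and \<open>G\<close> the last block column of the identity, so that
  \<open>N N\<^sup>T + G G\<^sup>T = I\<close>. The columns of the leading coefficient \<open>[S, E]\<close> of \<open>[A\<^sub>s, - B\<^sub>s]\<close> are zero or
  columns of the Hankel matrix: \<open>S = T N\<close> and \<open>E = T G\<close>; transposing \<open>P\<close> gives the same for rows.
  Hence the first block rows and columns vanish, because \<open>U\<^sub>1\<^sup>* T = 0\<close> and \<open>T V\<^sub>1 = 0\<close>.
  Moreover \<open>A\<^sub>s(\<lambda>) = T (\<lambda> N - I)\<close>, where \<open>\<lambda> N - I\<close> is triangular with diagonal \<open>-1\<close> and so has a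
  polynomial inverse \<open>K\<close>; therefore \<open>V\<^sub>2\<^sup>* K V\<^sub>2 That\<^sup>-\<^sup>1\<close> is a polynomial inverse of the compressed \<open>A\<close>,
  which thus has full rank at every point. At infinity, \<open>T = S N\<^sup>T + E G\<^sup>T\<close> yields one-sided inverses
  of the leading coefficients. Finally, for the block column \<open>c\<close> of the powers
  \<open>\<lambda>\<^sup>d\<^sup>-\<^sup>1, \<dots>, \<lambda>\<close>, a telescoping sum gives \<open>A\<^sub>s c = B\<^sub>s\<close> and \<open>C\<^sub>s c + D\<^sub>s = P\<close>, and this solution
  survives the compression.
\<close>

section \<open>Block matrices and ranks\<close>

lemma mult_mat_assoc:
  fixes A B C :: "'a :: semiring_0 mat"
  assumes "dim_col A = dim_row B" "dim_col B = dim_row C"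
  shows "A * B * C = A * (B * C)"
  by (rule assoc_mult_mat[of A "dim_row A" "dim_row B" B "dim_row C"]) (use assms in auto)

lemma index_mult_mat_sum:
  assumes "i < dim_row A" "j < dim_col B" "dim_col A = dim_row B"
  shows "(A * B) $$ (i, j) = (\<Sum>k<dim_row B. A $$ (i, k) * B $$ (k, j))"
  using assms by (simp add: scalar_prod_def lessThan_atLeast0)

text \<open>Each \<open>v\<close> is the image of \<open>X *\<^sub>v v\<close>, so the column space
  is all of the \<open>r\<close>-dimensional space.\<close>

lemma mat_rank_right_inverse:
  fixes M X :: "'a :: field mat"
  assumes M: "M \<in> carrier_mat r c" and X: "X \<in> carrier_mat c r" and MX: "M * X = 1\<^sub>m r"
  shows "mat_rank M = r"
proof -
  interpret vec_space "TYPE('a)" r .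
  have "col_space M = carrier_vec r"
  proof (intro equalityI subsetI)
    fix v :: "'a vec" assume v: "v \<in> carrier_vec r"
    have "M *\<^sub>v (X *\<^sub>v v) = v"
      using assoc_mult_mat_vec[OF M X v] MX v by simp
    then show "v \<in> col_space M"
      unfolding col_space_eq[OF M] using M X v by (auto intro!: bexI[of _ "X *\<^sub>v v"])
  qed (use M in \<open>auto simp: col_space_eq[OF M]\<close>)
  then have "rank M = dim"
    unfolding rank_def col_space_def by (simp add: module_vec_def)
  then show ?thesis using M by (simp add: dim_is_n)
qed

text \<open>A left inverse makes multiplication by \<open>M\<close> injective, so no nonzero vector
  is annihilated and the columns are independent.\<close>

lemma mat_rank_left_inverse:
  fixes M X :: "'a :: field mat"
  assumes M: "M \<in> carrier_mat r c" and X: "X \<in> carrier_mat c r" and XM: "X * M = 1\<^sub>m c"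
  shows "mat_rank M = c"
proof -
  interpret vec_space "TYPE('a)" r .
  have inj: "v = w" if "v \<in> carrier_vec c" "w \<in> carrier_vec c" "M *\<^sub>v v = M *\<^sub>v w" for v w
    using assoc_mult_mat_vec[OF X M that(1)] assoc_mult_mat_vec[OF X M that(2)] that XM by simp
  \<comment> \<open>Independence and rank are phrased for the set of columns, so repeated columns
    have to be excluded first. Column \<open>k\<close> is the image of the \<open>k\<close>-th unit
    vector, and injectivity separates these.\<close>
  have dist: "distinct (cols M)"
  proof (subst distinct_conv_nth, intro allI impI)
    fix i j assume ij: "i < length (cols M)" "j < length (cols M)" "i \<noteq> j"
    show "cols M ! i \<noteq> cols M ! j"
    proof
      assume eq: "cols M ! i = cols M ! j"
      have "M *\<^sub>v unit_vec c k = cols M ! k" if "k < c" for k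
        using that M by (intro eq_vecI) auto
      then have "M *\<^sub>v unit_vec c i = M *\<^sub>v unit_vec c j"
        using eq ij M by simp
      then show False
        using inj[of "unit_vec c i" "unit_vec c j"] ij M by (auto simp: unit_vec_eq)
    qed
  qed
  have "lin_indpt (set (cols M))"
  proof
    assume "lin_dep (set (cols M))"
    from lin_depE[OF M this dist] obtain v
      where v: "v \<in> carrier_vec c" "v \<noteq> 0\<^sub>v c" "M *\<^sub>v v = 0\<^sub>v r" .
    moreover have "M *\<^sub>v 0\<^sub>v c = 0\<^sub>v r" using M by (intro eq_vecI) auto
    ultimately show False using inj[of v "0\<^sub>v c"] by simp
  qed
  from lin_indpt_full_rank[OF M dist this] show ?thesis using M by simp
qed

lemma index_mat_adjoint [simp]:
  "i < dim_col A \<Longrightarrow> j < dim_row A \<Longrightarrow> mat_adjoint A $$ (i, j) = conjugate (A $$ (j, i))"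
  "dim_row (mat_adjoint A) = dim_col A"
  "dim_col (mat_adjoint A) = dim_row A"
  unfolding mat_adjoint_def by (auto simp: mat_of_rows_def)

lemma index_append_cols [simp]:
  "dim_row A = dim_row B \<Longrightarrow> i < dim_row A \<Longrightarrow> j < dim_col A + dim_col B \<Longrightarrow>
    (A @\<^sub>c B) $$ (i, j) = (if j < dim_col A then A $$ (i, j) else B $$ (i, j - dim_col A))"
  "dim_row (A @\<^sub>c B) = dim_row A"
  "dim_col (A @\<^sub>c B) = dim_col A + dim_col B"
  unfolding append_cols_def by auto

lemma index_append_rows [simp]:
  "dim_col A = dim_col B \<Longrightarrow> i < dim_row A + dim_row B \<Longrightarrow> j < dim_col A \<Longrightarrow>
    (A @\<^sub>r B) $$ (i, j) = (if i < dim_row A then A $$ (i, j) else B $$ (i - dim_row A, j))"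
  "dim_row (A @\<^sub>r B) = dim_row A + dim_row B"
  "dim_col (A @\<^sub>r B) = dim_col A"
  unfolding append_rows_def by auto

lemma mat_adjoint_append_cols:
  assumes "dim_row A = dim_row B"
  shows "mat_adjoint (A @\<^sub>c B) = mat_adjoint A @\<^sub>r mat_adjoint B"
  using assms by (intro eq_matI) auto

lemma append_rows_mult:
  fixes X Y M :: "'a :: comm_semiring_0 mat"
  assumes "dim_col X = dim_row M" "dim_col Y = dim_row M"
  shows "(X @\<^sub>r Y) * M = (X * M) @\<^sub>r (Y * M)"
  using assms by (intro eq_matI) (auto simp: index_mult_mat_sum simp del: index_mult_mat(1))

lemma mult_append_cols:
  fixes X Y M :: "'a :: comm_semiring_0 mat"
  assumes "dim_row X = dim_col M" "dim_row Y = dim_col M"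
  shows "M * (X @\<^sub>c Y) = (M * X) @\<^sub>c (M * Y)"
  using assms by (intro eq_matI) (auto simp: index_mult_mat_sum simp del: index_mult_mat(1))

lemma sum_lessThan_add:
  fixes f :: "nat \<Rightarrow> 'a :: comm_monoid_add"
  shows "(\<Sum>k<b + c. f k) = (\<Sum>k<b. f k) + (\<Sum>k<c. f (b + k))"
  by (induction c) (auto simp: add.assoc)

lemma append_cols_mult_append_rows:
  fixes X Y Z W :: "'a :: comm_semiring_0 mat"
  assumes "X \<in> carrier_mat a b" "Y \<in> carrier_mat a c" "Z \<in> carrier_mat b e" "W \<in> carrier_mat c e"
  shows "(X @\<^sub>c Y) * (Z @\<^sub>r W) = X * Z + Y * W"
proof (rule eq_matI)
  fix i j assume ij: "i < dim_row (X * Z + Y * W)" "j < dim_col (X * Z + Y * W)"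
  have "((X @\<^sub>c Y) * (Z @\<^sub>r W)) $$ (i, j) = (\<Sum>k<b+c. (X @\<^sub>c Y) $$ (i, k) * (Z @\<^sub>r W) $$ (k, j))"
    using ij assms by (simp add: index_mult_mat_sum del: index_mult_mat(1))
  also have "\<dots> = (\<Sum>k<b. X $$ (i, k) * Z $$ (k, j)) + (\<Sum>k<c. Y $$ (i, k) * W $$ (k, j))"
    using ij assms by (simp add: sum_lessThan_add)
  also have "\<dots> = (X * Z + Y * W) $$ (i, j)"
    using ij assms by (simp add: index_mult_mat_sum del: index_mult_mat(1))
  finally show "((X @\<^sub>c Y) * (Z @\<^sub>r W)) $$ (i, j) = (X * Z + Y * W) $$ (i, j)" .
qed (use assms in auto)

lemma append_rows_mult_append_cols:
  fixes X Y Z W :: "'a :: comm_semiring_0 mat"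
  assumes "dim_col X = dim_row Z" "dim_col Y = dim_row Z" "dim_row W = dim_row Z"
  shows "(X @\<^sub>r Y) * (Z @\<^sub>c W) = four_block_mat (X * Z) (X * W) (Y * Z) (Y * W)"
  using assms by (intro eq_matI) (auto simp: index_mult_mat_sum simp del: index_mult_mat(1))

section \<open>Matrix pencils\<close>

text \<open>This is \<open>\<lambda> M1 + M0\<close>: leading coefficient first, constant term with
  a plus sign, so that the constant term of \<open>A_s P\<close> becomes
  \<open>- hankel_T P\<close>. The dimensions are read off \<open>M1\<close> alone.\<close>

definition pencil :: "complex mat \<Rightarrow> complex mat \<Rightarrow> complex poly mat" where
  "pencil M1 M0 = mat (dim_row M1) (dim_col M1) (\<lambda>(i, j). [:M0 $$ (i, j), M1 $$ (i, j):])"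

lemma index_pencil [simp]:
  "i < dim_row M1 \<Longrightarrow> j < dim_col M1 \<Longrightarrow> pencil M1 M0 $$ (i, j) = [:M0 $$ (i, j), M1 $$ (i, j):]"
  "dim_row (pencil M1 M0) = dim_row M1"
  "dim_col (pencil M1 M0) = dim_col M1"
  unfolding pencil_def by auto

lemma index_const_pmat [simp]:
  "i < dim_row M \<Longrightarrow> j < dim_col M \<Longrightarrow> const_pmat M $$ (i, j) = [:M $$ (i, j):]"
  "dim_row (const_pmat M) = dim_row M"
  "dim_col (const_pmat M) = dim_col M"
  unfolding const_pmat_def by auto

lemma const_pmat_mult:
  "dim_col X = dim_row Y \<Longrightarrow> const_pmat (X * Y) = const_pmat X * const_pmat Y"
  unfolding const_pmat_def
  by (rule coeff_lift_hom.mat_hom_mult[of X "dim_row X" "dim_row Y" Y "dim_col Y"]) auto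

lemma const_pmat_one [simp]: "const_pmat (1\<^sub>m n) = 1\<^sub>m n"
  unfolding const_pmat_def by (rule coeff_lift_hom.mat_hom_one)

lemma sum_pCons: "(\<Sum>i\<in>A. [:f i, g i:]) = [:sum f A, sum g A:]" for f g :: "_ \<Rightarrow> 'a :: comm_monoid_add"
  by (induction A rule: infinite_finite_induct) auto

lemma const_pmat_mult_pencil:
  assumes "dim_col X = dim_row M1" "dim_row M0 = dim_row M1" "dim_col M0 = dim_col M1"
  shows "const_pmat X * pencil M1 M0 = pencil (X * M1) (X * M0)"
  using assms
  by (intro eq_matI) (auto simp: index_mult_mat_sum sum_pCons mult.commute simp del: index_mult_mat(1))

lemma pencil_mult_const_pmat:
  assumes "dim_row X = dim_col M1" "dim_row M0 = dim_row M1" "dim_col M0 = dim_col M1"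
  shows "pencil M1 M0 * const_pmat X = pencil (M1 * X) (M0 * X)"
  using assms
  by (intro eq_matI) (auto simp: index_mult_mat_sum sum_pCons mult.commute simp del: index_mult_mat(1))

lemma pencil_append_cols:
  assumes "M1 \<in> carrier_mat a b" "M0 \<in> carrier_mat a b" "N1 \<in> carrier_mat a c" "N0 \<in> carrier_mat a c"
  shows "pencil M1 M0 @\<^sub>c pencil N1 N0 = pencil (M1 @\<^sub>c N1) (M0 @\<^sub>c N0)"
  using assms by (intro eq_matI) auto

lemma pencil_append_rows:
  assumes "M1 \<in> carrier_mat a c" "M0 \<in> carrier_mat a c" "N1 \<in> carrier_mat b c" "N0 \<in> carrier_mat b c"
  shows "pencil M1 M0 @\<^sub>r pencil N1 N0 = pencil (M1 @\<^sub>r N1) (M0 @\<^sub>r N0)"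
  using assms by (intro eq_matI) auto

lemma pmat_coeff_pencil:
  "pmat_coeff (pencil M1 M0) 1 = M1"
  unfolding pmat_coeff_def by (intro eq_matI) auto

lemma finite_elements_mat: "finite (elements_mat M)"
  unfolding elements_mat_def by auto

lemma degree_index_le_pmat_degree:
  assumes "i < dim_row P" "j < dim_col P"
  shows "degree (P $$ (i, j)) \<le> pmat_degree P"
proof -
  have "degree (P $$ (i, j)) \<in> degree ` elements_mat P"
    using assms by (force simp: elements_mat_def)
  then show ?thesis
    unfolding pmat_degree_def by (intro Max_ge) (auto simp: finite_elements_mat)
qed

lemma pmat_degree_le_iff:
  "pmat_degree P \<le> k \<longleftrightarrow> (\<forall>i<dim_row P. \<forall>j<dim_col P. degree (P $$ (i, j)) \<le> k)"
proof
  show "pmat_degree P \<le> k" if "\<forall>i<dim_row P. \<forall>j<dim_col P. degree (P $$ (i, j)) \<le> k"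
    using that unfolding pmat_degree_def by (auto simp: finite_elements_mat elements_mat_def)
qed (meson degree_index_le_pmat_degree le_trans)

lemma pmat_degree_transpose: "pmat_degree (transpose_mat P) = pmat_degree P"
proof (rule antisym)
  show "pmat_degree (transpose_mat P) \<le> pmat_degree P"
    unfolding pmat_degree_le_iff[of "transpose_mat P"] by (auto intro: degree_index_le_pmat_degree)
  show "pmat_degree P \<le> pmat_degree (transpose_mat P)"
    unfolding pmat_degree_le_iff[of P]
    using degree_index_le_pmat_degree[of _ "transpose_mat P"] by fastforce
qed

lemma pmat_degree_pencil_le: "pmat_degree (pencil M1 M0) \<le> 1"
  unfolding pmat_degree_le_iff by auto

text \<open>The degree is exactly 1 because degree 0 would force \<open>M1 = 0\<close>, whose rank 0
  contradicts \<open>p > 0\<close>.\<close>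

lemma deg1_no_eigenvalues_pencil:
  assumes p: "p > 0"
    and fin: "\<And>z. mat_rank (pmat_eval (pencil M1 M0) z) = p"
    and inf: "mat_rank M1 = p"
  shows "deg1_no_eigenvalues p (pencil M1 M0)"
proof -
  have "pmat_degree (pencil M1 M0) \<noteq> 0"
  proof
    assume "pmat_degree (pencil M1 M0) = 0"
    then have *: "degree (pencil M1 M0 $$ (i, j)) = 0" if "i < dim_row M1" "j < dim_col M1" for i j
      using degree_index_le_pmat_degree[of i "pencil M1 M0" j] that by simp
    have "M1 $$ (i, j) = 0" if "i < dim_row M1" "j < dim_col M1" for i j
      using *[OF that] that by (auto split: if_splits)
    then have "M1 = 0\<^sub>m (dim_row M1) (dim_col M1)"
      by (intro eq_matI) auto
    then have "mat_rank M1 = 0"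
      by (metis vec_space.rank_0I)
    with inf p show False by simp
  qed
  with pmat_degree_pencil_le[of M1 M0] have "pmat_degree (pencil M1 M0) = 1" by linarith
  with fin inf show ?thesis by (simp add: deg1_no_eigenvalues_def pmat_coeff_pencil del: One_nat_def)
qed

section \<open>Block shifts\<close>

text \<open>The Kronecker product of the \<open>k \<times> k\<close> superdiagonal shift with the
  identity of size \<open>n\<close>. Multiplying by it on the right moves block columns one place to
  the right.\<close>

definition block_shift :: "nat \<Rightarrow> nat \<Rightarrow> 'a :: {zero, one} mat" where
  "block_shift n k = mat (n * k) (n * k) (\<lambda>(i, j). if j = i + n then 1 else 0)"

definition block_last :: "nat \<Rightarrow> nat \<Rightarrow> 'a :: {zero, one} mat" where
  "block_last n k = mat (n * k) n (\<lambda>(i, j). if i = j + n * (k - 1) then 1 else 0)"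

lemma index_block_shift [simp]:
  "i < n * k \<Longrightarrow> j < n * k \<Longrightarrow> block_shift n k $$ (i, j) = (if j = i + n then 1 else 0)"
  "dim_row (block_shift n k) = n * k" "dim_col (block_shift n k) = n * k"
  unfolding block_shift_def by auto

lemma index_block_last [simp]:
  "i < n * k \<Longrightarrow> j < n \<Longrightarrow> block_last n k $$ (i, j) = (if i = j + n * (k - 1) then 1 else 0)"
  "dim_row (block_last n k) = n * k" "dim_col (block_last n k) = n"
  unfolding block_last_def by auto

lemma index_mult_block_shift:
  fixes A :: "'a :: comm_semiring_1 mat"
  assumes "dim_col A = n * k" "i < dim_row A" "j < n * k"
  shows "(A * block_shift n k) $$ (i, j) = (if n \<le> j then A $$ (i, j - n) else 0)"
proof -
  have "(A * block_shift n k) $$ (i, j) = (\<Sum>l<n * k. A $$ (i, l) * block_shift n k $$ (l, j))"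
    using assms by (subst index_mult_mat_sum) auto
  \<comment> \<open>At most \<open>l = j - n\<close> contributes. The guard \<open>n \<le> j\<close>
    stays inside the summand because the difference of naturals is truncated to 0 for
    \<open>j < n\<close>.\<close>
  also have "\<dots> = (\<Sum>l<n * k. if l = j - n then (if n \<le> j then A $$ (i, l) else 0) else 0)"
    using assms by (intro sum.cong) auto
  also have "\<dots> = (if n \<le> j then A $$ (i, j - n) else 0)"
    using assms by (subst sum.delta) auto
  finally show ?thesis .
qed

lemma index_mult_block_last:
  fixes A :: "'a :: comm_semiring_1 mat"
  assumes "dim_col A = n * k" "k > 0" "i < dim_row A" "j < n"
  shows "(A * block_last n k) $$ (i, j) = A $$ (i, j + n * (k - 1))"
proof -
  have *: "j + n * (k - 1) < n * k"
    using assms by (cases k) auto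
  have "(A * block_last n k) $$ (i, j) = (\<Sum>l<n * k. A $$ (i, l) * block_last n k $$ (l, j))"
    using assms by (subst index_mult_mat_sum) auto
  also have "\<dots> = (\<Sum>l<n * k. if l = j + n * (k - 1) then A $$ (i, l) else 0)"
    using assms by (intro sum.cong) auto
  also have "\<dots> = A $$ (i, j + n * (k - 1))"
    using * by (subst sum.delta) auto
  finally show ?thesis .
qed

text \<open>The first product is the projection onto the first \<open>k - 1\<close> blocks, the
  second the projection onto the last block. This is what recovers \<open>T\<close> from the leading
  coefficients when infinite eigenvalues are excluded.\<close>

lemma block_shift_resolution:
  assumes "k > 0"
  shows "block_shift n k * transpose_mat (block_shift n k) + block_last n k * transpose_mat (block_last n k)
    = (1\<^sub>m (n * k) :: 'a :: comm_semiring_1 mat)"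
proof (rule eq_matI)
  let ?N = "block_shift n k :: 'a mat" and ?G = "block_last n k :: 'a mat"
  fix i j assume "i < dim_row (1\<^sub>m (n * k) :: 'a mat)" "j < dim_col (1\<^sub>m (n * k) :: 'a mat)"
  then have ij: "i < n * k" "j < n * k" by auto
  have nk: "n * k = n * (k - 1) + n"
    using assms by (cases k) auto
  have "(?N * transpose_mat ?N) $$ (i, j) = (\<Sum>l<n * k. ?N $$ (i, l) * transpose_mat ?N $$ (l, j))"
    using ij by (subst index_mult_mat_sum) auto
  also have "\<dots> = (\<Sum>l<n * k. if l = i + n then (if i = j then 1 else 0) else 0)"
    using ij by (intro sum.cong) auto
  also have "\<dots> = (if i = j \<and> i < n * (k - 1) then 1 else 0)"
    unfolding nk by (subst sum.delta) auto
  finally have 1: "(?N * transpose_mat ?N) $$ (i, j) = (if i = j \<and> i < n * (k - 1) then 1 else 0)" .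
  have "(?G * transpose_mat ?G) $$ (i, j) = (\<Sum>l<n. ?G $$ (i, l) * transpose_mat ?G $$ (l, j))"
    using ij by (subst index_mult_mat_sum) auto
  also have "\<dots> = (\<Sum>l<n. if l = i - n * (k - 1) then (if i = j \<and> i \<ge> n * (k - 1) then 1 else 0) else 0)"
    using ij by (intro sum.cong) auto
  also have "\<dots> = (if i = j \<and> i \<ge> n * (k - 1) then 1 else 0)"
    using ij unfolding nk by (subst sum.delta) auto
  finally show "(?N * transpose_mat ?N + ?G * transpose_mat ?G) $$ (i, j) = 1\<^sub>m (n * k) $$ (i, j)"
    using 1 ij by simp
qed auto

text \<open>The map \<open>t \<mapsto> n * t + j\<close> is a bijection onto the contributing
  indices, with inverse \<open>l \<mapsto> l div n\<close>.\<close>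

lemma sum_filter_mod:
  fixes f :: "nat \<Rightarrow> 'a :: comm_monoid_add"
  assumes "j < n"
  shows "(\<Sum>l<n * k. if l mod n = j then f l else 0) = (\<Sum>t<k. f (n * t + j))"
proof -
  have "(\<Sum>t<k. f (n * t + j)) = (\<Sum>l\<in>{l\<in>{..<n * k}. l mod n = j}. f l)"
  proof (rule sum.reindex_bij_witness[of _ "\<lambda>l. l div n" "\<lambda>t. n * t + j"])
    fix t assume t: "t \<in> {..<k}"
    have "n * t + j < n * Suc t" using assms by simp
    also have "\<dots> \<le> n * k" using t by (intro mult_le_mono2) auto
    finally show "n * t + j \<in> {l\<in>{..<n * k}. l mod n = j}" using assms by simp
  qed (use assms in \<open>auto simp: less_mult_imp_div_less mult.commute\<close>)
  also have "\<dots> = (\<Sum>l<n * k. if l mod n = j then f l else 0)"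
    by (rule sum.inter_filter) simp
  finally show ?thesis by simp
qed

text \<open>Since \<open>n > 0\<close>, the shift lies strictly above the diagonal, so the
  determinant is a sign and hence a unit. The adjugate then gives an inverse over the ring itself;
  it is needed over the polynomials, with \<open>x\<close> the variable.\<close>

lemma shift_pencil_inverse:
  fixes x :: "'a :: comm_ring_1"
  assumes "n > 0"
  shows "\<exists>K\<in>carrier_mat (n * k) (n * k). (x \<cdot>\<^sub>m block_shift n k - 1\<^sub>m (n * k)) * K = 1\<^sub>m (n * k)"
proof -
  define L where "L = x \<cdot>\<^sub>m block_shift n k - 1\<^sub>m (n * k)"
  have L: "L \<in> carrier_mat (n * k) (n * k)" unfolding L_def by auto
  have ut: "upper_triangular L"
    using L assms by (intro upper_triangularI) (auto simp: L_def)
  have "diag_mat L = replicate (n * k) (- 1)"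
    using L assms by (intro nth_equalityI) (auto simp: L_def diag_mat_def)
  then have det: "det L = (- 1) ^ (n * k)"
    by (subst det_upper_triangular[OF ut L]) simp
  \<comment> \<open>\<open>L\<close> times its adjugate is \<open>det L\<close> times the identity,
    and the sign \<open>det L\<close> is its own inverse.\<close>
  define K where "K = (- 1) ^ (n * k) \<cdot>\<^sub>m adj_mat L"
  have "L * K = 1\<^sub>m (n * k)"
    using adj_mat[OF L] L
    by (auto simp: K_def det mult_smult_distrib[OF L] mult_smult_assoc_mat[of _ "n * k" "n * k"]
      simp flip: power_add mult_2)
  moreover have "K \<in> carrier_mat (n * k) (n * k)"
    using adj_mat[OF L] by (auto simp: K_def)
  ultimately show ?thesis unfolding L_def by blast
qed

section \<open>Hankel matrices of a polynomial matrix\<close>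

text \<open>With blocks counted from 0, block \<open>(a, b)\<close> is the coefficient of index
  \<open>s - a - b\<close>. For \<open>D = d - 1\<close>, the choice \<open>s = 2 * D\<close> gives
  \<open>T\<close> and \<open>s = 2 * D + 1\<close> gives the leading coefficient of
  \<open>A_s P\<close>.\<close>

definition hankel_mat :: "complex poly mat \<Rightarrow> nat \<Rightarrow> nat \<Rightarrow> complex mat" where
  "hankel_mat P D s = mat (dim_row P * D) (dim_col P * D) (\<lambda>(i, j).
     coeff (P $$ (i mod dim_row P, j mod dim_col P)) (s - i div dim_row P - j div dim_col P))"

definition hankel_col :: "complex poly mat \<Rightarrow> nat \<Rightarrow> complex mat" where
  "hankel_col P D = mat (dim_row P * D) (dim_col P) (\<lambda>(i, j).
     coeff (P $$ (i mod dim_row P, j)) (Suc D - i div dim_row P))"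

definition hankel_row :: "complex poly mat \<Rightarrow> nat \<Rightarrow> complex mat" where
  "hankel_row P D = mat (dim_row P) (dim_col P * D) (\<lambda>(i, j).
     coeff (P $$ (i, j mod dim_col P)) (Suc D - j div dim_col P))"

lemma dim_hankel [simp]:
  "dim_row (hankel_mat P D s) = dim_row P * D" "dim_col (hankel_mat P D s) = dim_col P * D"
  "dim_row (hankel_col P D) = dim_row P * D" "dim_col (hankel_col P D) = dim_col P"
  "dim_row (hankel_row P D) = dim_row P" "dim_col (hankel_row P D) = dim_col P * D"
  by (auto simp: hankel_mat_def hankel_col_def hankel_row_def)

lemma index_hankel [simp]:
  "i < dim_row P * D \<Longrightarrow> j < dim_col P * D \<Longrightarrow> hankel_mat P D s $$ (i, j) =
     coeff (P $$ (i mod dim_row P, j mod dim_col P)) (s - i div dim_row P - j div dim_col P)"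
  "i < dim_row P * D \<Longrightarrow> j < dim_col P \<Longrightarrow> hankel_col P D $$ (i, j) =
     coeff (P $$ (i mod dim_row P, j)) (Suc D - i div dim_row P)"
  "i < dim_row P \<Longrightarrow> j < dim_col P * D \<Longrightarrow> hankel_row P D $$ (i, j) =
     coeff (P $$ (i, j mod dim_col P)) (Suc D - j div dim_col P)"
  by (auto simp: hankel_mat_def hankel_col_def hankel_row_def)

lemma mod_less_of_less_mult: "i < n * k \<Longrightarrow> i mod n < n" for i n k :: nat
  by (cases "n = 0") auto

lemma div_less_of_less_mult: "i < n * k \<Longrightarrow> i div n < k" for i n k :: nat
  by (simp add: less_mult_imp_div_less mult.commute)

text \<open>Transposing \<open>P\<close> exchanges block rows and block columns; this reduces the
  identities for left multiplication to those for right multiplication.\<close>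

lemma hankel_mat_transpose: "hankel_mat (transpose_mat P) D s = transpose_mat (hankel_mat P D s)"
  by (intro eq_matI) (auto simp: hankel_mat_def mod_less_of_less_mult add.commute)

lemma hankel_row_conv_transpose: "hankel_row P D = transpose_mat (hankel_col (transpose_mat P) D)"
  by (intro eq_matI) (auto simp: hankel_row_def hankel_col_def mod_less_of_less_mult)

lemma index_blocks [simp]:
  "i < m * k \<Longrightarrow> j < n * l \<Longrightarrow>
    blocks k l m n F $$ (i, j) = F (Suc (i div m)) (Suc (j div n)) $$ (i mod m, j mod n)"
  "dim_row (blocks k l m n F) = m * k" "dim_col (blocks k l m n F) = n * l"
  unfolding blocks_def by auto

lemma index_pmat_coeff [simp]:
  "i < dim_row P \<Longrightarrow> j < dim_col P \<Longrightarrow> pmat_coeff P k $$ (i, j) = coeff (P $$ (i, j)) k"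
  "dim_row (pmat_coeff P k) = dim_row P" "dim_col (pmat_coeff P k) = dim_col P"
  unfolding pmat_coeff_def by auto

lemma hankel_T_eq: "hankel_T P = hankel_mat P (pmat_degree P - 1) (2 * pmat_degree P - 2)"
proof (rule eq_matI)
  define d where "d = pmat_degree P"
  fix i j
  assume "i < dim_row (hankel_mat P (pmat_degree P - 1) (2 * pmat_degree P - 2))"
    "j < dim_col (hankel_mat P (pmat_degree P - 1) (2 * pmat_degree P - 2))"
  then have ij: "i < dim_row P * (d - 1)" "j < dim_col P * (d - 1)" by (auto simp: d_def)
  note ij' = ij[THEN mod_less_of_less_mult]
  have "2 * d - Suc a - Suc b = 2 * d - 2 - a - b" for a b by simp
  then show "hankel_T P $$ (i, j) = hankel_mat P (pmat_degree P - 1) (2 * pmat_degree P - 2) $$ (i, j)"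
    unfolding hankel_T_def Let_def d_def[symmetric] index_blocks(1)[OF ij] index_hankel(1)[OF ij]
      index_pmat_coeff(1)[OF ij'] by presburger
qed (auto simp: hankel_T_def Let_def)

lemma A_s_eq:
  "A_s P = pencil (hankel_mat P (pmat_degree P - 1) (2 * pmat_degree P - 1)) (- hankel_T P)"
proof (rule eq_matI)
  define d where "d = pmat_degree P"
  let ?S = "hankel_mat P (pmat_degree P - 1) (2 * pmat_degree P - 1)"
  fix i j assume "i < dim_row (pencil ?S (- hankel_T P))" "j < dim_col (pencil ?S (- hankel_T P))"
  then have ij: "i < dim_row P * (d - 1)" "j < dim_col P * (d - 1)" by (auto simp: d_def)
  note ij' = ij[THEN mod_less_of_less_mult]
  have eq: "2 * d - Suc a - Suc b = 2 * d - 2 - a - b" "2 * d + 1 - Suc a - Suc b = 2 * d - 1 - a - b"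
    for a b by simp_all
  have "A_s P $$ (i, j) = [:- coeff (P $$ (i mod dim_row P, j mod dim_col P)) (2 * d - 2 - i div dim_row P - j div dim_col P),
      coeff (P $$ (i mod dim_row P, j mod dim_col P)) (2 * d - 1 - i div dim_row P - j div dim_col P):]"
    unfolding A_s_def Let_def d_def[symmetric] index_blocks(1)[OF ij] eq using ij' by simp
  then show "A_s P $$ (i, j) = pencil ?S (- hankel_T P) $$ (i, j)"
    using ij by (simp only: hankel_T_eq d_def[symmetric]) (simp only: index_pencil dim_hankel
      index_uminus_mat index_hankel)
qed (auto simp: A_s_def Let_def)

lemma B_s_eq:
  assumes "pmat_degree P > 0"
  shows "- B_s P = pencil (hankel_col P (pmat_degree P - 1)) (0\<^sub>m (dim_row P * (pmat_degree P - 1)) (dim_col P))"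
  unfolding B_s_def Let_def using assms
  by (intro eq_matI) (simp_all add: hankel_col_def mod_less_of_less_mult)

lemma C_s_eq:
  assumes "pmat_degree P > 0"
  shows "C_s P = pencil (hankel_row P (pmat_degree P - 1)) (0\<^sub>m (dim_row P) (dim_col P * (pmat_degree P - 1)))"
  unfolding C_s_def Let_def using assms
  by (intro eq_matI) (simp_all add: hankel_row_def mod_less_of_less_mult)

lemma D_s_eq: "D_s P = pencil (pmat_coeff P 1) (pmat_coeff P 0)"
  unfolding D_s_def by (intro eq_matI) (auto simp: pmat_coeff_def)

lemma coeff_above_pmat_degree:
  assumes "i < dim_row P" "j < dim_col P" "pmat_degree P < k"
  shows "coeff (P $$ (i, j)) k = 0"
  using degree_index_le_pmat_degree[OF assms(1,2)] assms(3) by (intro coeff_eq_0) linarith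

text \<open>Replacing \<open>b\<close> by \<open>b - 1\<close> in the index
  \<open>2 * D - a - b\<close> raises it by one, as required. Only the vacated first block column
  needs the degree bound.\<close>

lemma hankel_mat_mult_block_shift:
  assumes "pmat_degree P = Suc D"
  shows "hankel_mat P D (2 * D) * block_shift (dim_col P) D = hankel_mat P D (2 * D + 1)"
proof (rule eq_matI)
  fix i j assume "i < dim_row (hankel_mat P D (2 * D + 1))" "j < dim_col (hankel_mat P D (2 * D + 1))"
  then have ij: "i < dim_row P * D" "j < dim_col P * D" by auto
  note ij' = ij[THEN mod_less_of_less_mult] ij[THEN div_less_of_less_mult]
  have shift: "(hankel_mat P D (2 * D) * block_shift (dim_col P) D) $$ (i, j) =
      (if dim_col P \<le> j then hankel_mat P D (2 * D) $$ (i, j - dim_col P) else 0)"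
    using ij by (intro index_mult_block_shift) auto
  show "(hankel_mat P D (2 * D) * block_shift (dim_col P) D) $$ (i, j) = hankel_mat P D (2 * D + 1) $$ (i, j)"
  proof (cases "dim_col P \<le> j")
    case True
    then obtain j' where j: "j = j' + dim_col P" by (metis le_add_diff_inverse2)
    have "dim_col P > 0" "j' < dim_col P * D"
      using ij j by (auto intro: gr0I)
    then have "hankel_mat P D (2 * D) $$ (i, j') = hankel_mat P D (2 * D + 1) $$ (i, j)"
      using ij by (simp only: index_hankel) (simp add: j)
    then show ?thesis unfolding shift using True by (simp add: j)
  next
    case False
    \<comment> \<open>Here the block column is 0 and the block row is at most \<open>D - 1\<close>,
      so the index is at least \<open>D + 2\<close>, beyond the degree \<open>D + 1\<close>.\<close>
    have "2 * D + 1 - i div dim_row P - j div dim_col P > Suc D"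
      using False ij' by simp
    then have "coeff (P $$ (i mod dim_row P, j mod dim_col P)) (2 * D + 1 - i div dim_row P - j div dim_col P) = 0"
      using ij' assms by (intro coeff_above_pmat_degree) metis+
    then show ?thesis
      unfolding shift index_hankel(1)[OF ij] using False by simp
  qed
qed auto

text \<open>The last block column has \<open>b = D - 1\<close>, and
  \<open>2 * D - a - (D - 1) = D + 1 - a\<close>.\<close>

lemma hankel_mat_mult_block_last:
  assumes "D > 0"
  shows "hankel_mat P D (2 * D) * block_last (dim_col P) D = hankel_col P D"
proof (rule eq_matI)
  fix i j assume "i < dim_row (hankel_col P D)" "j < dim_col (hankel_col P D)"
  then have ij: "i < dim_row P * D" "j < dim_col P" by auto
  obtain e where e: "D = Suc e"
    using assms gr0_implies_Suc by blast
  have j: "j + dim_col P * (D - 1) < dim_col P * D"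
    using ij by (simp add: e)
  have "(hankel_mat P D (2 * D) * block_last (dim_col P) D) $$ (i, j)
      = hankel_mat P D (2 * D) $$ (i, j + dim_col P * (D - 1))"
    using ij assms by (intro index_mult_block_last) auto
  also have "\<dots> = coeff (P $$ (i mod dim_row P, j)) (2 * D - i div dim_row P - (D - 1))"
    unfolding index_hankel(1)[OF ij(1) j] using ij by simp
  also have "2 * D - i div dim_row P - (D - 1) = Suc D - i div dim_row P"
    by (simp add: e)
  finally show "(hankel_mat P D (2 * D) * block_last (dim_col P) D) $$ (i, j) = hankel_col P D $$ (i, j)"
    unfolding index_hankel(2)[OF ij] .
qed auto

lemma transpose_mult_eq_transpose:
  fixes A B :: "'a :: comm_semiring_0 mat"
  assumes "dim_row A = dim_row B"
  shows "transpose_mat A * B = transpose_mat (transpose_mat B * A)"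
  using assms by (subst transpose_mult[of _ "dim_col B" "dim_row B" _ "dim_col A"]) auto

lemma block_shift_mult_hankel_mat:
  assumes "pmat_degree P = Suc D"
  shows "transpose_mat (block_shift (dim_row P) D) * hankel_mat P D (2 * D) = hankel_mat P D (2 * D + 1)"
proof (subst transpose_mult_eq_transpose)
  show "transpose_mat (transpose_mat (hankel_mat P D (2 * D)) * block_shift (dim_row P) D)
      = hankel_mat P D (2 * D + 1)"
    using hankel_mat_mult_block_shift[of "transpose_mat P" D] assms
    by (simp add: pmat_degree_transpose hankel_mat_transpose)
qed simp

lemma block_last_mult_hankel_mat:
  assumes "D > 0"
  shows "transpose_mat (block_last (dim_row P) D) * hankel_mat P D (2 * D) = hankel_row P D"
proof (subst transpose_mult_eq_transpose)
  show "transpose_mat (transpose_mat (hankel_mat P D (2 * D)) * block_last (dim_row P) D) = hankel_row P D"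
    using hankel_mat_mult_block_last[OF assms, of "transpose_mat P"]
    by (simp add: hankel_mat_transpose hankel_row_conv_transpose)
qed simp

text \<open>The top right block of \<open>T\<close> is the leading coefficient of \<open>P\<close>,
  and some entry of \<open>P\<close> attains the degree. This is what later rules out
  \<open>r = 0\<close>.\<close>

lemma hankel_T_nonzero:
  assumes "pmat_degree P > 1"
  shows "hankel_T P \<noteq> 0\<^sub>m (dim_row P * (pmat_degree P - 1)) (dim_col P * (pmat_degree P - 1))"
proof -
  have "pmat_degree P \<in> insert 0 (degree ` elements_mat P)"
    unfolding pmat_degree_def by (intro Max_in) (auto simp: finite_elements_mat)
  then have "pmat_degree P \<in> degree ` elements_mat P"
    using assms by (simp only: insert_iff) linarith
  then obtain p where p: "pmat_degree P = degree p" "p \<in> elements_mat P"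
    by (rule imageE)
  from elements_matD[OF p(2)] obtain i j where ij: "i < dim_row P" "j < dim_col P" "p = P $$ (i, j)"
    by (elim exE conjE) (rule that)
  \<comment> \<open>Column \<open>j\<close> of the last block column, which has number
    \<open>d - 2\<close> when counted from 0; row \<open>i\<close> lies in block row 0.\<close>
  let ?j = "j + dim_col P * (pmat_degree P - 2)"
  define e where "e = pmat_degree P - 2"
  have e: "pmat_degree P = Suc (Suc e)"
    using assms unfolding e_def by simp
  have lt: "?j < dim_col P * (pmat_degree P - 1)" "i < dim_row P * (pmat_degree P - 1)"
    using ij(1,2) by (simp_all add: e)
  have "2 * pmat_degree P - 2 - (pmat_degree P - 2) = pmat_degree P"
    by (simp add: e)
  then have "hankel_T P $$ (i, ?j) = coeff (P $$ (i, j)) (pmat_degree P)"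
    unfolding hankel_T_eq index_hankel(1)[OF lt(2,1)] using ij(1,2) by simp
  also have "\<dots> = lead_coeff p"
    unfolding ij(3)[symmetric] p(1) ..
  also have "lead_coeff p \<noteq> 0"
    by (rule leading_coeff_neq_0) (metis p(1) e degree_0 nat.distinct(1))
  finally have "hankel_T P $$ (i, ?j) \<noteq> 0" .
  then show ?thesis
    by (metis index_zero_mat(1) lt)
qed

section \<open>The block column of powers and the equations it solves\<close>

definition power_col :: "nat \<Rightarrow> nat \<Rightarrow> complex poly mat" where
  "power_col n k = mat (n * k) n (\<lambda>(i, j). if i mod n = j then monom 1 (k - i div n) else 0)"

lemma index_power_col [simp]:
  "i < n * k \<Longrightarrow> j < n \<Longrightarrow> power_col n k $$ (i, j) = (if i mod n = j then monom 1 (k - i div n) else 0)"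
  "dim_row (power_col n k) = n * k" "dim_col (power_col n k) = n"
  unfolding power_col_def by auto

lemma pencil_block_shift_eq:
  "pencil (block_shift n k) (- 1\<^sub>m (n * k)) = [:0, 1:] \<cdot>\<^sub>m block_shift n k - 1\<^sub>m (n * k)"
  by (intro eq_matI) auto

text \<open>The blocks of \<open>power_col n k\<close> are
  \<open>\<lambda>^k, ..., \<lambda>\<close> times the identity. Each is \<open>\<lambda>\<close>
  times the next, so the shift pencil annihilates every block row except the last, where the
  remaining \<open>- \<lambda>\<close> is cancelled by the second summand. Left multiplication by
  \<open>T\<close> turns this into \<open>A\<^sub>s c = B\<^sub>s\<close>.\<close>

lemma shift_pencil_mult_power_col:
  assumes "k > 0"
  shows "pencil (block_shift n k) (- 1\<^sub>m (n * k)) * power_col n k + pencil (block_last n k) (0\<^sub>m (n * k) n)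
    = 0\<^sub>m (n * k) n"
proof (rule eq_matI)
  let ?L = "pencil (block_shift n k) (- 1\<^sub>m (n * k))" and ?c = "power_col n k"
  fix i j assume "i < dim_row (0\<^sub>m (n * k) n :: complex poly mat)" "j < dim_col (0\<^sub>m (n * k) n :: complex poly mat)"
  then have ij: "i < n * k" "j < n" by auto
  have n: "n > 0" using ij by simp
  have "(?L * ?c) $$ (i, j) = (\<Sum>l<n * k. ?L $$ (i, l) * ?c $$ (l, j))"
    using ij by (subst index_mult_mat_sum) auto
  \<comment> \<open>Row \<open>i\<close> of the pencil has at most two nonzero entries, at
    \<open>i + n\<close> and \<open>i\<close>; they are distinct because \<open>n > 0\<close>. In
    the last block row \<open>i + n\<close> is out of range.\<close>
  also have "\<dots> = (\<Sum>l<n * k. (if l = i + n then [:0, 1:] * ?c $$ (l, j) else 0) - (if l = i then ?c $$ (l, j) else 0))"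
    using ij n by (intro sum.cong) auto
  also have "\<dots> = (if i + n < n * k then [:0, 1:] * ?c $$ (i + n, j) else 0) - ?c $$ (i, j)"
    using ij(1) by (simp only: sum_subtractf sum.delta finite_lessThan) simp
  finally have 1: "(?L * ?c) $$ (i, j) = (if i + n < n * k then [:0, 1:] * ?c $$ (i + n, j) else 0) - ?c $$ (i, j)" .
  have 2: "(?L * ?c) $$ (i, j) = - [:0, if i = j + n * (k - 1) then 1 else 0:]"
  proof (cases "i + n < n * k")
    case True
    then have "i div n + 1 < k"
      using div_less_of_less_mult[OF True] n by simp
    moreover have "i \<noteq> j + n * (k - 1)"
      using True by (cases k) auto
    ultimately show ?thesis
      unfolding 1 index_power_col(1)[OF ij] index_power_col(1)[OF True ij(2)] using True n
      by (simp add: monom_Suc[symmetric] Suc_diff_Suc pCons_0_as_mult[symmetric])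
  next
    case False
    have "n * (k - 1) \<le> i"
      using False assms by (cases k) auto
    then have "k - 1 \<le> i div n"
      using n by (simp add: less_eq_div_iff_mult_less_eq mult.commute)
    then have dv: "i div n = k - 1"
      using div_less_of_less_mult[OF ij(1)] by simp
    have "i mod n = j \<longleftrightarrow> i = j + n * (k - 1)"
      using div_mult_mod_eq[of i n] dv ij(2) by (auto simp: mult.commute)
    moreover have "[:- 1:] = (- 1 :: complex poly)"
      by (simp only: one_pCons minus_pCons minus_zero)
    ultimately show ?thesis
      unfolding 1 index_power_col(1)[OF ij] dv using False assms
      by (simp add: monom_Suc monom_0)
  qed
  show "(?L * ?c + pencil (block_last n k) (0\<^sub>m (n * k) n)) $$ (i, j) = 0\<^sub>m (n * k) n $$ (i, j)"
    using 2 ij by (simp del: index_mult_mat(1))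
qed auto

text \<open>Block \<open>t\<close> contributes \<open>\<lambda> P_{D+1-t} \<lambda>^(D-t)\<close>,
  the term of degree \<open>D + 1 - t\<close> of \<open>P\<close>. So the product collects the
  degrees 2 to \<open>D + 1\<close>, and \<open>D_s P\<close> supplies degrees 1 and 0.\<close>

lemma hankel_row_mult_power_col:
  assumes "pmat_degree P = Suc D"
  shows "pencil (hankel_row P D) (0\<^sub>m (dim_row P) (dim_col P * D)) * power_col (dim_col P) D + D_s P = P"
proof (rule eq_matI)
  let ?F = "pencil (hankel_row P D) (0\<^sub>m (dim_row P) (dim_col P * D))" and ?c = "power_col (dim_col P) D"
  fix i j assume ij: "i < dim_row P" "j < dim_col P"
  define p where "p = P $$ (i, j)"
  define f where "f = (\<lambda>k. monom (coeff p k) k)"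
  have "degree p \<le> Suc D"
    using degree_index_le_pmat_degree[OF ij] assms by (simp add: p_def)
  then have "p = (\<Sum>k\<le>Suc D. f k)"
    unfolding f_def by (rule poly_as_sum_of_monoms'[symmetric])
  also have "\<dots> = f 0 + f 1 + (\<Sum>t<D. f (Suc (Suc t)))"
    unfolding lessThan_Suc_atMost[symmetric] by (simp only: sum.lessThan_Suc_shift o_def) (simp add: add.assoc)
  \<comment> \<open>The sum is reversed because the block row lists the coefficients from the
    highest index down.\<close>
  also have "(\<Sum>t<D. f (Suc (Suc t))) = (\<Sum>t<D. f (Suc (Suc (D - Suc t))))"
    by (rule sum.nat_diff_reindex[symmetric])
  also have "\<dots> = (\<Sum>t<D. [:0, coeff p (Suc D - t):] * monom 1 (D - t))"
  proof (rule sum.cong)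
    fix t assume "t \<in> {..<D}"
    then have *: "Suc D - t = Suc (Suc (D - Suc t))" "D - t = Suc (D - Suc t)" by auto
    show "f (Suc (Suc (D - Suc t))) = [:0, coeff p (Suc D - t):] * monom 1 (D - t)"
      unfolding * f_def by (simp add: monom_Suc smult_monom)
  qed simp
  also have "\<dots> = (\<Sum>l<dim_col P * D. if l mod dim_col P = j
      then [:0, coeff p (Suc D - l div dim_col P):] * monom 1 (D - l div dim_col P) else 0)"
    using ij by (subst sum_filter_mod) auto
  also have "\<dots> = (\<Sum>l<dim_col P * D. ?F $$ (i, l) * ?c $$ (l, j))"
    using ij by (intro sum.cong) (auto simp: p_def)
  also have "\<dots> = (?F * ?c) $$ (i, j)"
    using ij by (subst index_mult_mat_sum) auto
  finally have "P $$ (i, j) = f 0 + f 1 + (?F * ?c) $$ (i, j)"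
    by (simp add: p_def)
  moreover have "f 0 + f 1 = D_s P $$ (i, j)"
    using ij by (simp add: D_s_eq f_def p_def monom_0 monom_Suc)
  moreover have "(?F * ?c + D_s P) $$ (i, j) = (?F * ?c) $$ (i, j) + D_s P $$ (i, j)"
    using ij by (intro index_add_mat(1)) (auto simp: D_s_eq)
  ultimately show "(?F * ?c + D_s P) $$ (i, j) = P $$ (i, j)"
    by (simp only: add.commute)
qed (auto simp: D_s_eq)

section \<open>Evaluation, rational functions and transfer functions\<close>

lemma rmat_mult: "dim_col X = dim_row Y \<Longrightarrow> rmat (X * Y) = rmat X * rmat Y"
  by (rule to_fract_hom.mat_hom_mult[of X "dim_row X" "dim_row Y" Y "dim_col Y"]) auto

lemma pmat_eval_mult: "dim_col X = dim_row Y \<Longrightarrow> pmat_eval (X * Y) z = pmat_eval X z * pmat_eval Y z"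
  unfolding pmat_eval_def
  by (intro eq_matI) (auto simp: index_mult_mat_sum poly_sum simp del: index_mult_mat(1))

lemma dim_pmat_eval [simp]:
  "dim_row (pmat_eval X z) = dim_row X" "dim_col (pmat_eval X z) = dim_col X"
  unfolding pmat_eval_def by auto

lemma pmat_eval_one: "pmat_eval (1\<^sub>m n) z = 1\<^sub>m n"
  unfolding pmat_eval_def by (intro eq_matI) auto

lemma pmat_eval_append_cols:
  "dim_row X = dim_row Y \<Longrightarrow> pmat_eval (X @\<^sub>c Y) z = pmat_eval X z @\<^sub>c pmat_eval Y z"
  unfolding pmat_eval_def by (intro eq_matI) auto

lemma pmat_eval_append_rows:
  "dim_col X = dim_col Y \<Longrightarrow> pmat_eval (X @\<^sub>r Y) z = pmat_eval X z @\<^sub>r pmat_eval Y z"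
  unfolding pmat_eval_def by (intro eq_matI) auto

text \<open>\<open>mat_inverse\<close> returns an option, so the value under \<open>the\<close> is
  meaningful only once invertibility is known; for square matrices over a field a right inverse
  suffices.\<close>

lemma mat_inverse_existence:
  fixes A X :: "'a :: field mat"
  assumes A: "A \<in> carrier_mat n n" and X: "X \<in> carrier_mat n n" and AX: "A * X = 1\<^sub>m n"
  shows "the (mat_inverse A) * A = 1\<^sub>m n" "the (mat_inverse A) \<in> carrier_mat n n"
proof -
  have "A \<in> Units (ring_mat TYPE('a) n undefined)"
    using A X AX mat_mult_left_right_inverse[OF A X AX] by (auto simp: Units_def ring_mat_simps)
  then have "mat_inverse A \<noteq> None"
    using mat_inverse(1)[OF A, of undefined] by blast
  then show "the (mat_inverse A) * A = 1\<^sub>m n" "the (mat_inverse A) \<in> carrier_mat n n"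
    using mat_inverse(2)[OF A] by auto
qed

text \<open>The inverse of \<open>A\<close> cancels against \<open>B = A * Y\<close>, leaving the
  polynomial matrix \<open>C * Y + D\<close>. The polynomial inverse \<open>X\<close> guarantees
  invertibility over the rational functions.\<close>

lemma transfer_function_eqI:
  assumes A: "A \<in> carrier_mat r r" and X: "X \<in> carrier_mat r r" and AX: "A * X = 1\<^sub>m r"
    and B: "B = A * Y" and Y: "Y \<in> carrier_mat r n"
    and C: "C \<in> carrier_mat m r" and D: "D \<in> carrier_mat m n" and R: "C * Y + D = R"
  shows "transfer_function A B C D = rmat R"
proof -
  let ?I = "the (mat_inverse (rmat A))"
  have "rmat A * rmat X = 1\<^sub>m r"
    using A X by (simp flip: rmat_mult add: AX to_fract_hom.mat_hom_one)
  from mat_inverse_existence[OF _ _ this] have I: "?I * rmat A = 1\<^sub>m r" "?I \<in> carrier_mat r r"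
    using A X by auto
  have "rmat C * ?I * rmat B = rmat C * ((?I * rmat A) * rmat Y)"
    using A Y C I(2) by (simp add: B rmat_mult mult_mat_assoc)
  also have "\<dots> = rmat (C * Y)"
    using Y C by (simp add: I(1) rmat_mult)
  finally show ?thesis
    unfolding transfer_function_def R[symmetric] using C D Y
    by (intro eq_matI) (auto simp: add.commute)
qed

section \<open>The compressed pencil\<close>

text \<open>In the application \<open>W\<close> and \<open>V'\<close> are the adjoints of
  \<open>U = U2\<close> and \<open>V = V2\<close>, and \<open>J\<close> is the inverse of
  \<open>That\<close>. The products \<open>U * W\<close> and \<open>V * V'\<close> act as identities
  on \<open>T\<close> from the left and from the right.\<close>

lemma compressed_pencil_strongly_minimal_linearization:
  assumes P: "P \<in> carrier_mat m n" and deg: "pmat_degree P = Suc D" "D > 0" and r: "r > 0"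
    and W: "W \<in> carrier_mat r (m * D)" and U: "U \<in> carrier_mat (m * D) r"
    and V: "V \<in> carrier_mat (n * D) r" and V': "V' \<in> carrier_mat r (n * D)"
    and J: "J \<in> carrier_mat r r"
    and UWT: "U * W * hankel_T P = hankel_T P" and TVV: "hankel_T P * (V * V') = hankel_T P"
    and WTVJ: "W * hankel_T P * V * J = 1\<^sub>m r" and JWTV: "J * (W * hankel_T P * V) = 1\<^sub>m r"
  shows "strongly_minimal_linearization (const_pmat W * A_s P * const_pmat V) (const_pmat W * B_s P)
    (C_s P * const_pmat V) (D_s P) (rmat P)"
    and "regular_pmat (const_pmat W * A_s P * const_pmat V)"
proof -
  define T S E F N G where "T = hankel_T P" and "S = hankel_mat P D (2 * D + 1)"
    and "E = hankel_col P D" and "F = hankel_row P D"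
    and "N = (block_shift n D :: complex mat)" and "G = (block_last n D :: complex mat)"
  define N' G' where "N' = (block_shift m D :: complex mat)" and "G' = (block_last m D :: complex mat)"
  have dims [simp]: "dim_row P = m" "dim_col P = n" "dim_row W = r" "dim_col W = m * D"
    "dim_row U = m * D" "dim_col U = r" "dim_row V = n * D" "dim_col V = r"
    "dim_row V' = r" "dim_col V' = n * D" "dim_row J = r" "dim_col J = r"
    using P W U V V' J by auto
  have T_eq: "T = hankel_mat P D (2 * D)"
    by (simp add: T_def hankel_T_eq deg)
  have dims' [simp]: "dim_row T = m * D" "dim_col T = n * D" "dim_row S = m * D" "dim_col S = n * D"
    "dim_row E = m * D" "dim_col E = n" "dim_row F = m" "dim_col F = n * D"
    "dim_row N = n * D" "dim_col N = n * D" "dim_row G = n * D" "dim_col G = n"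
    "dim_row N' = m * D" "dim_col N' = m * D" "dim_row G' = m * D" "dim_col G' = m"
    by (auto simp: T_eq S_def E_def F_def N_def G_def N'_def G'_def)
  note assoc = mult_mat_assoc
  have TN: "T * N = S" and TG: "T * G = E" and NT: "transpose_mat N' * T = S" and GT: "transpose_mat G' * T = F"
    using hankel_mat_mult_block_shift[OF deg(1)] hankel_mat_mult_block_last[OF deg(2), of P]
      block_shift_mult_hankel_mat[OF deg(1)] block_last_mult_hankel_mat[OF deg(2), of P]
    by (simp_all add: T_eq S_def E_def F_def N_def G_def N'_def G'_def)
  note UWT' = UWT[folded T_def] and TVV' = TVV[folded T_def]
  \<comment> \<open>\<open>S\<close> and \<open>F\<close> are left multiples of \<open>T\<close>, so
    they absorb \<open>V * V'\<close> on the right as \<open>T\<close> does; as a right multiple of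
    \<open>T\<close>, \<open>S\<close> also absorbs \<open>U * W\<close> on the left.\<close>
  have SVV: "S * (V * V') = S" and FVV: "F * (V * V') = F"
    using TVV' by (simp_all add: assoc flip: NT GT)
  have UWS: "U * W * S = S"
    using UWT' by (simp add: assoc flip: TN) (simp flip: assoc)
  have A_s: "A_s P = pencil S (- T)" and B_s: "- B_s P = pencil E (0\<^sub>m (m * D) n)"
    and C_s: "C_s P = pencil F (0\<^sub>m m (n * D))"
    using A_s_eq[of P] B_s_eq[of P] C_s_eq[of P] by (simp_all add: deg S_def T_def E_def F_def)
  have dimB [simp]: "dim_row (B_s P) = m * D" "dim_col (B_s P) = n"
    using arg_cong[OF B_s, of dim_row] arg_cong[OF B_s, of dim_col] by auto
  define Ah Bm Ch where "Ah = const_pmat W * A_s P * const_pmat V"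
    and "Bm = const_pmat W * (- B_s P)" and "Ch = C_s P * const_pmat V"
  have Ah: "Ah = pencil (W * S * V) (W * (- T) * V)"
    by (simp add: Ah_def A_s const_pmat_mult_pencil pencil_mult_const_pmat)
  have Bm: "Bm = pencil (W * E) (W * 0\<^sub>m (m * D) n)"
    by (simp add: Bm_def B_s const_pmat_mult_pencil)
  have Ch: "Ch = pencil (F * V) (0\<^sub>m m (n * D) * V)"
    by (simp add: Ch_def C_s pencil_mult_const_pmat)
  have Bm_minus: "Bm = - (const_pmat W * B_s P)"
    by (simp add: Bm_def)

  define L where "L = pencil N (- 1\<^sub>m (n * D))"
  have A_sL: "A_s P = const_pmat T * L"
    by (simp add: A_s L_def const_pmat_mult_pencil TN)
  \<comment> \<open>Without columns the degree would be 0. Positivity makes the diagonal of the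
    shift pencil \<open>L\<close> equal to \<open>- 1\<close>.\<close>
  have "n > 0"
  proof (rule ccontr)
    assume "\<not> n > 0"
    then have "pmat_degree P \<le> 0" unfolding pmat_degree_le_iff by simp
    then show False using deg by simp
  qed
  then obtain K where K: "K \<in> carrier_mat (n * D) (n * D)" "L * K = 1\<^sub>m (n * D)"
    using shift_pencil_inverse[where n = n and k = D and x = "[:0, 1:] :: complex poly"] unfolding L_def N_def pencil_block_shift_eq by blast
  have dimK [simp]: "dim_row K = n * D" "dim_col K = n * D" "dim_row L = n * D" "dim_col L = n * D"
    using K by (auto simp: L_def)
  have A_sVV: "A_s P * const_pmat (V * V') = A_s P"
    using SVV TVV' by (simp add: A_s pencil_mult_const_pmat)
  have C_sVV: "C_s P * const_pmat (V * V') = C_s P"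
    using FVV by (simp add: C_s pencil_mult_const_pmat)
  have dimAC [simp]: "dim_row (A_s P) = m * D" "dim_col (A_s P) = n * D"
    "dim_row (C_s P) = m" "dim_col (C_s P) = n * D"
    by (auto simp: A_s C_s)
  \<comment> \<open>In \<open>Ah * X\<close> the inner \<open>V * V'\<close> is absorbed by
    \<open>A_s P = T * L\<close>, then \<open>L * K\<close> cancels and
    \<open>W * T * V * J = 1\<close> remains.\<close>
  define X where "X = const_pmat V' * K * const_pmat (V * J)"
  have X: "X \<in> carrier_mat r r" by (intro carrier_matI) (simp_all add: X_def)
  have AhC: "Ah \<in> carrier_mat r r" by (intro carrier_matI) (simp_all add: Ah_def)
  have AhX: "Ah * X = 1\<^sub>m r"
  proof -
    have "Ah * X = const_pmat W * (A_s P * const_pmat (V * V')) * K * const_pmat (V * J)"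
      by (simp add: Ah_def X_def assoc const_pmat_mult)
    also have "\<dots> = const_pmat W * const_pmat T * (L * K) * const_pmat (V * J)"
      unfolding A_sVV unfolding A_sL by (simp add: assoc)
    also have "\<dots> = const_pmat (W * T * V * J)"
      by (simp add: K const_pmat_mult assoc)
    finally show ?thesis
      using WTVJ by (simp add: T_def)
  qed
  have "det Ah * det X = 1"
    using det_mult[OF AhC X] AhX by simp
  then have reg: "regular_pmat Ah"
    using AhC by (auto simp: regular_pmat_def)

  let ?c = "power_col n D"
  have "A_s P * ?c + (- B_s P) = const_pmat T * (L * ?c) + const_pmat T * pencil G (0\<^sub>m (n * D) n)"
    by (simp add: A_sL B_s assoc const_pmat_mult_pencil TG)
  also have "\<dots> = const_pmat T * (L * ?c + pencil G (0\<^sub>m (n * D) n))"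
    by (rule mult_add_distrib_mat[symmetric, of _ "m * D" "n * D" _ n]) (auto intro!: carrier_matI)
  also have "L * ?c + pencil G (0\<^sub>m (n * D) n) = 0\<^sub>m (n * D) n"
    unfolding L_def N_def G_def by (rule shift_pencil_mult_power_col[OF deg(2)])
  also have "const_pmat T * 0\<^sub>m (n * D) n = 0\<^sub>m (m * D) n"
    by (intro eq_matI) auto
  finally have Ac: "A_s P * ?c + (- B_s P) = 0\<^sub>m (m * D) n" .
  have B_sc: "B_s P = A_s P * ?c"
  proof (rule eq_matI)
    fix i j assume ij: "i < dim_row (A_s P * ?c)" "j < dim_col (A_s P * ?c)"
    have "(A_s P * ?c + (- B_s P)) $$ (i, j) = (A_s P * ?c) $$ (i, j) - B_s P $$ (i, j)"
      using ij by (simp del: index_mult_mat(1))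
    then show "B_s P $$ (i, j) = (A_s P * ?c) $$ (i, j)"
      using ij unfolding Ac by simp
  qed auto
  \<comment> \<open>The compressed form of the power column: since \<open>A_s P\<close> and
    \<open>C_s P\<close> absorb \<open>V * V'\<close>, replacing \<open>?c\<close> by
    \<open>V * Y\<close> changes neither product.\<close>
  define Y where "Y = const_pmat V' * ?c"
  have Y: "Y \<in> carrier_mat r n" by (intro carrier_matI) (simp_all add: Y_def)
  have BY: "const_pmat W * B_s P = Ah * Y"
  proof -
    have "Ah * Y = const_pmat W * (A_s P * const_pmat (V * V')) * ?c"
      by (simp add: Ah_def Y_def assoc const_pmat_mult)
    also have "\<dots> = const_pmat W * B_s P"
      unfolding A_sVV by (simp add: assoc B_sc)
    finally show ?thesis ..
  qed
  have CY: "Ch * Y + D_s P = P"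
  proof -
    have "Ch * Y = (C_s P * const_pmat (V * V')) * ?c"
      by (simp add: Ch_def Y_def assoc const_pmat_mult)
    also have "\<dots> = C_s P * ?c" unfolding C_sVV ..
    finally show ?thesis
      using hankel_row_mult_power_col[OF deg(1)] by (simp add: C_s F_def)
  qed
  have D_s: "D_s P \<in> carrier_mat m n" by (intro carrier_matI) (simp_all add: D_s_eq)
  have ChC: "Ch \<in> carrier_mat m r" by (intro carrier_matI) (simp_all add: Ch_def)
  have tf: "transfer_function Ah (const_pmat W * B_s P) Ch (D_s P) = rmat P"
    by (rule transfer_function_eqI[OF AhC X AhX BY Y ChC D_s CY])

  \<comment> \<open>A polynomial inverse can be evaluated at every \<open>z\<close>, so
    \<open>Ah\<close> has full rank at all finite points.\<close>
  have ev: "pmat_eval Ah z * pmat_eval X z = 1\<^sub>m r" for z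
    using AhX AhC X by (simp flip: pmat_eval_mult add: pmat_eval_one)
  have ev': "pmat_eval X z * pmat_eval Ah z = 1\<^sub>m r" for z
    by (rule mat_mult_left_right_inverse[OF _ _ ev]) (use AhC X in \<open>auto intro!: carrier_matI\<close>)
  have AB: "Ah @\<^sub>c Bm = pencil (W * S * V @\<^sub>c W * E) (W * (- T) * V @\<^sub>c W * 0\<^sub>m (m * D) n)"
    unfolding Ah Bm by (rule pencil_append_cols[of _ r r _ _ n]) (auto intro!: carrier_matI)
  have AC: "Ah @\<^sub>r Ch = pencil (W * S * V @\<^sub>r F * V) (W * (- T) * V @\<^sub>r 0\<^sub>m m (n * D) * V)"
    unfolding Ah Ch by (rule pencil_append_rows[of _ r r _ _ m]) (auto intro!: carrier_matI)
  have dimABC [simp]: "dim_row Ah = r" "dim_col Ah = r" "dim_row Bm = r" "dim_col Bm = n"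
    "dim_row Ch = m" "dim_col Ch = r" "dim_row X = r" "dim_col X = r"
    using AhC ChC X by (auto simp: Bm)

  have no_ev_B: "deg1_no_eigenvalues r (Ah @\<^sub>c Bm)"
    unfolding AB
  \<comment> \<open>The rule matches only the joined pencil. Folding \<open>AB\<close> back allows
    finite points to be treated blockwise: the inverse of \<open>Ah\<close> padded by zeros is a
    right inverse.\<close>
  proof (rule deg1_no_eigenvalues_pencil[OF r], unfold AB[symmetric])
    fix z
    have "pmat_eval (Ah @\<^sub>c Bm) z * (pmat_eval X z @\<^sub>r 0\<^sub>m n r) = pmat_eval Ah z * pmat_eval X z + pmat_eval Bm z * 0\<^sub>m n r"
      by (subst pmat_eval_append_cols, simp, rule append_cols_mult_append_rows[of _ r r _ n]) (auto intro!: carrier_matI)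
    also have "\<dots> = 1\<^sub>m r"
      unfolding ev by (intro eq_matI) auto
    finally show "mat_rank (pmat_eval (Ah @\<^sub>c Bm) z) = r"
      by (intro mat_rank_right_inverse[of _ r "r + n" "pmat_eval X z @\<^sub>r 0\<^sub>m n r"]) (auto intro!: carrier_matI)
  next
    \<comment> \<open>The right inverse at infinity comes from
      \<open>T = S N\<^sup>T + E G\<^sup>T\<close>: compressed by \<open>W\<close> and
      \<open>V * J\<close>, this identity becomes \<open>1\<close>. The factor \<open>V'\<close> in
      \<open>?X1\<close> meets the \<open>V\<close> of the leading coefficient, and \<open>S\<close>
      absorbs \<open>V * V'\<close>.\<close>
    let ?X1 = "V' * transpose_mat N * V * J" and ?X2 = "transpose_mat G * V * J"
    have "(W * S * V @\<^sub>c W * E) * (?X1 @\<^sub>r ?X2) = W * S * V * ?X1 + W * E * ?X2"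
      by (rule append_cols_mult_append_rows[of _ r r _ n]) (auto intro!: carrier_matI)
    also have "W * S * V * ?X1 = W * (S * (V * V')) * transpose_mat N * V * J"
      by (simp add: assoc)
    also have "\<dots> = W * T * (N * transpose_mat N) * (V * J)"
      unfolding SVV unfolding TN[symmetric] by (simp add: assoc)
    also have "W * E * ?X2 = W * T * (G * transpose_mat G) * (V * J)"
      unfolding TG[symmetric] by (simp add: assoc)
    also have "W * T * (N * transpose_mat N) * (V * J) + W * T * (G * transpose_mat G) * (V * J)
        = W * T * (N * transpose_mat N + G * transpose_mat G) * (V * J)"
      by (subst mult_add_distrib_mat[of _ r "n * D" _ "n * D"];
        (subst add_mult_distrib_mat[of _ r "n * D" _ _ r])?) (auto intro!: carrier_matI)
    also have "N * transpose_mat N + G * transpose_mat G = 1\<^sub>m (n * D)"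
      unfolding N_def G_def by (rule block_shift_resolution[OF deg(2)])
    also have "W * T * 1\<^sub>m (n * D) * (V * J) = 1\<^sub>m r"
      using WTVJ[folded T_def] by (simp add: assoc)
    finally show "mat_rank (W * S * V @\<^sub>c W * E) = r"
      by (intro mat_rank_right_inverse[of _ r "r + n" "?X1 @\<^sub>r ?X2"]) (auto intro!: carrier_matI)
  qed
  have no_ev_C: "deg1_no_eigenvalues r (Ah @\<^sub>r Ch)"
    unfolding AC
  proof (rule deg1_no_eigenvalues_pencil[OF r], unfold AC[symmetric])
    fix z
    have "(pmat_eval X z @\<^sub>c 0\<^sub>m r m) * pmat_eval (Ah @\<^sub>r Ch) z = pmat_eval X z * pmat_eval Ah z + 0\<^sub>m r m * pmat_eval Ch z"
      by (subst pmat_eval_append_rows, simp, rule append_cols_mult_append_rows[of _ r r _ m]) (auto intro!: carrier_matI)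
    also have "\<dots> = 1\<^sub>m r"
      unfolding ev' by (intro eq_matI) auto
    finally show "mat_rank (pmat_eval (Ah @\<^sub>r Ch) z) = r"
      by (intro mat_rank_left_inverse[of _ "r + m" r "pmat_eval X z @\<^sub>c 0\<^sub>m r m"]) (auto intro!: carrier_matI)
  next
    \<comment> \<open>Dually, \<open>T = N' S + G' F\<close> gives a left inverse; here
      \<open>U\<close> meets \<open>W\<close>, and \<open>S\<close> absorbs
      \<open>U * W\<close>.\<close>
    let ?X1 = "J * W * N' * U" and ?X2 = "J * W * G'"
    have "(?X1 @\<^sub>c ?X2) * (W * S * V @\<^sub>r F * V) = ?X1 * (W * S * V) + ?X2 * (F * V)"
      by (rule append_cols_mult_append_rows[of _ r r _ m]) (auto intro!: carrier_matI)
    also have "?X1 * (W * S * V) = J * W * N' * (U * W * S) * V"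
      by (simp add: assoc)
    also have "\<dots> = (J * W) * (N' * transpose_mat N') * (T * V)"
      unfolding UWS unfolding NT[symmetric] by (simp add: assoc)
    also have "?X2 * (F * V) = (J * W) * (G' * transpose_mat G') * (T * V)"
      unfolding GT[symmetric] by (simp add: assoc)
    also have "(J * W) * (N' * transpose_mat N') * (T * V) + (J * W) * (G' * transpose_mat G') * (T * V)
        = (J * W) * (N' * transpose_mat N' + G' * transpose_mat G') * (T * V)"
      by (subst mult_add_distrib_mat[of _ r "m * D" _ "m * D"];
        (subst add_mult_distrib_mat[of _ r "m * D" _ _ r])?) (auto intro!: carrier_matI)
    also have "N' * transpose_mat N' + G' * transpose_mat G' = 1\<^sub>m (m * D)"
      unfolding N'_def G'_def by (rule block_shift_resolution[OF deg(2)])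
    also have "(J * W) * 1\<^sub>m (m * D) * (T * V) = 1\<^sub>m r"
      using JWTV[folded T_def] by (simp add: assoc)
    finally show "mat_rank (W * S * V @\<^sub>r F * V) = r"
      by (intro mat_rank_left_inverse[of _ "r + m" r "?X1 @\<^sub>c ?X2"]) (auto intro!: carrier_matI)
  qed
  have "pmat_degree (four_block_mat Ah Bm Ch (D_s P)) \<le> 1"
    unfolding pmat_degree_le_iff using D_s by (auto simp: Ah Bm Ch D_s_eq)
  then have "linear_system_matrix Ah (const_pmat W * B_s P) Ch (D_s P)"
    using reg D_s by (auto simp: linear_system_matrix_def Bm_minus intro!: carrier_matI)
  then show "strongly_minimal_linearization (const_pmat W * A_s P * const_pmat V) (const_pmat W * B_s P)
    (C_s P * const_pmat V) (D_s P) (rmat P)"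
    using tf no_ev_B no_ev_C
    unfolding strongly_minimal_linearization_def strongly_minimal_def Bm_minus[symmetric]
      Ah_def[symmetric] Ch_def[symmetric] by simp
  show "regular_pmat (const_pmat W * A_s P * const_pmat V)"
    using reg by (simp add: Ah_def)
qed

section \<open>Block partitions and the compression by unitary matrices\<close>

lemma append_rows_mult_mult_append_cols:
  fixes X Y M Z W :: "'a :: comm_semiring_0 mat"
  assumes "dim_col X = dim_row M" "dim_col Y = dim_row M" "dim_row Z = dim_col M" "dim_row W = dim_col M"
  shows "(X @\<^sub>r Y) * M * (Z @\<^sub>c W) = four_block_mat (X * M * Z) (X * M * W) (Y * M * Z) (Y * M * W)"
  using assms by (subst append_rows_mult; (subst append_rows_mult_append_cols)?) simp_all

lemma four_block_mat_eqD:
  assumes "four_block_mat A B C D = four_block_mat A' B' C' D'"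
    and "A \<in> carrier_mat a c" "B \<in> carrier_mat a e" "C \<in> carrier_mat b c" "D \<in> carrier_mat b e"
    and "A' \<in> carrier_mat a c" "B' \<in> carrier_mat a e" "C' \<in> carrier_mat b c" "D' \<in> carrier_mat b e"
  shows "A = A'" "B = B'" "C = C'" "D = D'"
proof -
  have eq: "four_block_mat A B C D $$ (i, j) = four_block_mat A' B' C' D' $$ (i, j)" for i j
    using assms(1) by simp
  show "A = A'"
  proof (rule eq_matI)
    fix i j assume "i < dim_row A'" "j < dim_col A'"
    then show "A $$ (i, j) = A' $$ (i, j)" using eq[of i j] assms(2-) by simp
  qed (use assms in auto)
  show "B = B'"
  proof (rule eq_matI)
    fix i j assume "i < dim_row B'" "j < dim_col B'"
    then show "B $$ (i, j) = B' $$ (i, j)" using eq[of i "c + j"] assms(2-) by simp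
  qed (use assms in auto)
  show "C = C'"
  proof (rule eq_matI)
    fix i j assume "i < dim_row C'" "j < dim_col C'"
    then show "C $$ (i, j) = C' $$ (i, j)" using eq[of "a + i" j] assms(2-) by simp
  qed (use assms in auto)
  show "D = D'"
  proof (rule eq_matI)
    fix i j assume "i < dim_row D'" "j < dim_col D'"
    then show "D $$ (i, j) = D' $$ (i, j)" using eq[of "a + i" "c + j"] assms(2-) by simp
  qed (use assms in auto)
qed

lemma unitary_mat_mult_adjoint:
  assumes "unitary_mat U" and U: "U \<in> carrier_mat k k"
  shows "U * mat_adjoint U = 1\<^sub>m k"
proof (rule mat_mult_left_right_inverse[OF _ U])
  show "mat_adjoint U * U = 1\<^sub>m k"
    using assms by (simp add: unitary_mat_def)
  show "mat_adjoint U \<in> carrier_mat k k"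
    using U by (intro carrier_matI) simp_all
qed

lemma zero_mat_uminus: "- 0\<^sub>m a b = (0\<^sub>m a b :: 'a :: group_add mat)"
  by (intro eq_matI) auto

lemma const_pmat_append_rows: "dim_col X = dim_col Y \<Longrightarrow> const_pmat (X @\<^sub>r Y) = const_pmat X @\<^sub>r const_pmat Y"
  by (intro eq_matI) auto

lemma const_pmat_append_cols: "dim_row X = dim_row Y \<Longrightarrow> const_pmat (X @\<^sub>c Y) = const_pmat X @\<^sub>c const_pmat Y"
  by (intro eq_matI) auto

lemma diag2_four_block_mult:
  fixes X A B C D Y :: "'a :: comm_ring_1 mat"
  assumes "X \<in> carrier_mat a p" "Y \<in> carrier_mat q c"
    and "A \<in> carrier_mat p q" "B \<in> carrier_mat p n" "C \<in> carrier_mat m q" "D \<in> carrier_mat m n"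
  shows "diag2 X (1\<^sub>m m) * four_block_mat A B C D * diag2 Y (1\<^sub>m n) =
    four_block_mat (X * A * Y) (X * B) (C * Y) D"
proof -
  have X [simp]: "dim_row X = a" "dim_col X = p" and Y [simp]: "dim_row Y = q" "dim_col Y = c"
    using assms by simp_all
  have "diag2 X (1\<^sub>m m) * four_block_mat A B C D = four_block_mat (X * A + 0\<^sub>m a m * C) (X * B + 0\<^sub>m a m * D)
      (0\<^sub>m m p * A + 1\<^sub>m m * C) (0\<^sub>m m p * B + 1\<^sub>m m * D)"
    unfolding X index_one_mat by (rule mult_four_block_mat) (rule assms zero_carrier_mat one_carrier_mat)+
  also have "\<dots> = four_block_mat (X * A) (X * B) C D"
    using assms by (simp add: right_add_zero_mat[of _ a] left_add_zero_mat[of _ m])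
  finally have 1: "diag2 X (1\<^sub>m m) * four_block_mat A B C D = four_block_mat (X * A) (X * B) C D" .
  have "four_block_mat (X * A) (X * B) C D * diag2 Y (1\<^sub>m n) =
      four_block_mat (X * A * Y + X * B * 0\<^sub>m n c) (X * A * 0\<^sub>m q n + X * B * 1\<^sub>m n)
        (C * Y + D * 0\<^sub>m n c) (C * 0\<^sub>m q n + D * 1\<^sub>m n)"
    unfolding Y index_one_mat
    by (rule mult_four_block_mat) (rule assms zero_carrier_mat one_carrier_mat mult_carrier_mat)+
  also have "\<dots> = four_block_mat (X * A * Y) (X * B) (C * Y) D"
    using assms by (simp add: right_add_zero_mat[of _ a] right_add_zero_mat[of _ m]
      left_add_zero_mat[of _ a] left_add_zero_mat[of _ m])
  finally show ?thesis unfolding 1 .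
qed

theorem theorem3p2:
  fixes P :: "complex poly mat" and U U1 U2 V V1 V2 T That :: "complex mat" and m n d r :: nat
  assumes "P \<in> carrier_mat m n" and "pmat_degree P = d" and "d > 1"
    and "T = hankel_T P" and "r = mat_rank T"
    and "U1 \<in> carrier_mat (m * (d - 1)) (m * (d - 1) - r)"
    and "U2 \<in> carrier_mat (m * (d - 1)) r"
    and "V1 \<in> carrier_mat (n * (d - 1)) (n * (d - 1) - r)"
    and "V2 \<in> carrier_mat (n * (d - 1)) r"
    and "U = U1 @\<^sub>c U2" and "V = V1 @\<^sub>c V2"
    and "U \<in> carrier_mat (m * (d - 1)) (m * (d - 1))"
    and "V \<in> carrier_mat (n * (d - 1)) (n * (d - 1))"
    and "unitary_mat U" and "unitary_mat V"
    and "That = mat_adjoint U2 * T * V2"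
    and "mat_adjoint U * T * V =
           four_block_mat (0\<^sub>m (m * (d - 1) - r) (n * (d - 1) - r)) (0\<^sub>m (m * (d - 1) - r) r)
                          (0\<^sub>m r (n * (d - 1) - r)) That"
    and "invertible_mat That"
  shows "diag2 (const_pmat (mat_adjoint U)) (1\<^sub>m m) * L_s P * diag2 (const_pmat V) (1\<^sub>m n) =
           four_block_mat (const_pmat (mat_adjoint U) * A_s P * const_pmat V)
                          (- (const_pmat (mat_adjoint U) * B_s P))
                          (C_s P * const_pmat V) (D_s P)
       \<and> (\<exists>Ah Bh Ch Dh.
            Ah \<in> carrier_mat r r \<and> Bh \<in> carrier_mat r n \<and>
            Ch \<in> carrier_mat m r \<and> Dh \<in> carrier_mat m n \<and>
            four_block_mat (const_pmat (mat_adjoint U) * A_s P * const_pmat V)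
                           (- (const_pmat (mat_adjoint U) * B_s P))
                           (C_s P * const_pmat V) (D_s P) =
              four_block_mat
                (four_block_mat (0\<^sub>m (m * (d - 1) - r) (n * (d - 1) - r))
                                (0\<^sub>m (m * (d - 1) - r) r)
                                (0\<^sub>m r (n * (d - 1) - r)) Ah)
                (0\<^sub>m (m * (d - 1) - r) n @\<^sub>r (- Bh))
                (0\<^sub>m m (n * (d - 1) - r) @\<^sub>c Ch) Dh \<and>
            strongly_minimal_linearization Ah Bh Ch Dh (rmat P) \<and>
            regular_pmat Ah \<and>
            rmat P = rmat Dh + rmat Ch * the (mat_inverse (rmat Ah)) * rmat Bh)"
proof -
  define D where "D = d - 1"
  have deg: "pmat_degree P = Suc D" "D > 0"
    using assms(2,3) by (auto simp: D_def)
  define a b where "a = m * D - r" and "b = n * D - r"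
  have U1: "U1 \<in> carrier_mat (m * D) a" and U2: "U2 \<in> carrier_mat (m * D) r"
    and V1: "V1 \<in> carrier_mat (n * D) b" and V2: "V2 \<in> carrier_mat (n * D) r"
    and Uc: "U \<in> carrier_mat (m * D) (m * D)" and Vc: "V \<in> carrier_mat (n * D) (n * D)"
    using assms(6-9,12,13) by (simp_all add: D_def a_def b_def)
  let ?W1 = "mat_adjoint U1" and ?W2 = "mat_adjoint U2"
  have dims [simp]: "dim_row P = m" "dim_col P = n" "dim_row U1 = m * D" "dim_col U1 = a"
    "dim_row U2 = m * D" "dim_col U2 = r" "dim_row V1 = n * D" "dim_col V1 = b"
    "dim_row V2 = n * D" "dim_col V2 = r"
    using assms(1) U1 U2 V1 V2 by auto
  have T: "T = hankel_mat P D (2 * D)"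
    by (simp add: assms(4) hankel_T_eq deg)
  have dimT [simp]: "dim_row T = m * D" "dim_col T = n * D" by (simp_all add: T)
  have adjU: "mat_adjoint U = ?W1 @\<^sub>r ?W2"
    using assms(10) by (simp add: mat_adjoint_append_cols)
  have adjV: "mat_adjoint V = mat_adjoint V1 @\<^sub>r mat_adjoint V2"
    using assms(11) by (simp add: mat_adjoint_append_cols)
  \<comment> \<open>Unitarity in partitioned form splits the identity into the projections onto the
    column spaces of \<open>U1\<close> and \<open>U2\<close>; the same is done for
    \<open>V\<close>.\<close>
  have "U * mat_adjoint U = U1 * ?W1 + U2 * ?W2"
    unfolding adjU unfolding assms(10)
    by (rule append_cols_mult_append_rows[OF U1 U2]) (auto intro!: carrier_matI)
  then have resU: "U1 * ?W1 + U2 * ?W2 = 1\<^sub>m (m * D)"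
    using unitary_mat_mult_adjoint[OF assms(14) Uc] by simp
  have "V * mat_adjoint V = V1 * mat_adjoint V1 + V2 * mat_adjoint V2"
    unfolding adjV unfolding assms(11)
    by (rule append_cols_mult_append_rows[OF V1 V2]) (auto intro!: carrier_matI)
  then have resV: "V1 * mat_adjoint V1 + V2 * mat_adjoint V2 = 1\<^sub>m (n * D)"
    using unitary_mat_mult_adjoint[OF assms(15) Vc] by simp
  have "four_block_mat (?W1 * T * V1) (?W1 * T * V2) (?W2 * T * V1) (?W2 * T * V2) = mat_adjoint U * T * V"
    unfolding adjU assms(11) by (rule append_rows_mult_mult_append_cols[symmetric]) simp_all
  also have "\<dots> = four_block_mat (0\<^sub>m a b) (0\<^sub>m a r) (0\<^sub>m r b) That"
    using assms(17) unfolding D_def a_def b_def .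
  finally have blk: "four_block_mat (?W1 * T * V1) (?W1 * T * V2) (?W2 * T * V1) (?W2 * T * V2) =
    four_block_mat (0\<^sub>m a b) (0\<^sub>m a r) (0\<^sub>m r b) That" .
  have ThatC: "That \<in> carrier_mat r r"
    unfolding assms(16) by (intro carrier_matI) simp_all
  have blocks: "?W1 * T * V1 = 0\<^sub>m a b" "?W1 * T * V2 = 0\<^sub>m a r" "?W2 * T * V1 = 0\<^sub>m r b"
    by (rule four_block_mat_eqD[OF blk, of a b r r]; rule ThatC zero_carrier_mat carrier_matI; simp)+
  have resV_mult: "M * V1 * mat_adjoint V1 + M * V2 * mat_adjoint V2 = M" if M: "dim_col M = n * D" for M
  proof -
    have "M * (V1 * mat_adjoint V1 + V2 * mat_adjoint V2) = M * (V1 * mat_adjoint V1) + M * (V2 * mat_adjoint V2)"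
      by (rule mult_add_distrib_mat[of _ "dim_row M" "n * D" _ "n * D"]) (auto intro!: carrier_matI simp: M)
    then show ?thesis
      using M by (simp add: resV mult_mat_assoc)
  qed
  have resU_mult: "U1 * (?W1 * M) + U2 * (?W2 * M) = M" if M: "dim_row M = m * D" for M
  proof -
    have "(U1 * ?W1 + U2 * ?W2) * M = U1 * ?W1 * M + U2 * ?W2 * M"
      by (rule add_mult_distrib_mat[of _ "m * D" "m * D" _ _ "dim_col M"]) (auto intro!: carrier_matI simp: M)
    then show ?thesis
      using M by (simp add: resU mult_mat_assoc)
  qed
  \<comment> \<open>Inserting the resolution from \<open>V\<close> expresses \<open>?W1 * T\<close>
    through the two zero blocks of the upper row. Dually, \<open>T * V1\<close> uses the left block
    column. After that only the parts with \<open>U2\<close> and \<open>V2\<close> survive in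
    \<open>T\<close>.\<close>
  have W1T: "?W1 * T = 0\<^sub>m a (n * D)"
    using resV_mult[of "?W1 * T"] unfolding blocks by simp
  have TV1: "T * V1 = 0\<^sub>m (m * D) b"
    using resU_mult[of "T * V1"] blocks by (simp add: mult_mat_assoc)
  have UWT: "U2 * ?W2 * T = T"
    using resU_mult[of T] left_add_zero_mat[of "U2 * (?W2 * T)" "m * D" "n * D"]
    unfolding W1T by (simp add: mult_mat_assoc carrier_matI)
  have TVV: "T * (V2 * mat_adjoint V2) = T"
    using resV_mult[of T] left_add_zero_mat[of "T * V2 * mat_adjoint V2" "m * D" "n * D"]
    unfolding TV1 by (simp add: mult_mat_assoc carrier_matI)
  \<comment> \<open>For \<open>r = 0\<close> the product through \<open>U2\<close> is an empty sum,
    which would make \<open>T\<close> zero.\<close>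
  have r: "r > 0"
  proof (rule ccontr)
    assume "\<not> r > 0"
    then have "U2 * (?W2 * T) = 0\<^sub>m (m * D) (n * D)"
      by (intro eq_matI) (simp_all add: index_mult_mat_sum del: index_mult_mat(1))
    then have "T = 0\<^sub>m (m * D) (n * D)"
      using UWT by (simp add: mult_mat_assoc)
    then show False
      using hankel_T_nonzero[of P] deg by (simp add: assms(4))
  qed
  \<comment> \<open>\<open>inverts_mat\<close> only says that \<open>J * That\<close> is an identity
    of size \<open>dim_row J\<close>; comparing column counts in the two equations fixes both
    dimensions of \<open>J\<close>.\<close>
  obtain J where J: "That * J = 1\<^sub>m r" "J * That = 1\<^sub>m (dim_row J)"
    using assms(18) ThatC unfolding invertible_mat_def inverts_mat_def by (metis carrier_matD(1))
  have "dim_col J = r"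
    using arg_cong[OF J(1), of dim_col] by simp
  moreover have rowJ: "dim_row J = r"
    using arg_cong[OF J(2), of dim_col] ThatC by simp
  ultimately have JC: "J \<in> carrier_mat r r" by auto

  define Ah Bh Ch where "Ah = const_pmat ?W2 * A_s P * const_pmat V2"
    and "Bh = const_pmat ?W2 * B_s P" and "Ch = C_s P * const_pmat V2"
  have W2: "?W2 \<in> carrier_mat r (m * D)" and V2': "mat_adjoint V2 \<in> carrier_mat r (n * D)"
    by (intro carrier_matI; simp)+
  have TJ: "?W2 * T * V2 * J = 1\<^sub>m r" "J * (?W2 * T * V2) = 1\<^sub>m r"
    using J unfolding assms(16) rowJ by blast+
  note sml = compressed_pencil_strongly_minimal_linearization(1)[OF assms(1) deg r W2 U2 V2 V2' JC,
      folded assms(4) Ah_def Bh_def Ch_def, OF UWT TVV TJ]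
    and reg = compressed_pencil_strongly_minimal_linearization(2)[OF assms(1) deg r W2 U2 V2 V2' JC,
      folded assms(4) Ah_def, OF UWT TVV TJ]

  let ?S = "hankel_mat P D (Suc (2 * D))" and ?E = "hankel_col P D" and ?F = "hankel_row P D"
  have A_s: "A_s P = pencil ?S (- T)" and B_s: "- B_s P = pencil ?E (0\<^sub>m (m * D) n)"
    and C_s: "C_s P = pencil ?F (0\<^sub>m m (n * D))"
    using A_s_eq[of P] B_s_eq[of P] C_s_eq[of P] by (simp_all add: deg assms(4))
  have dimS [simp]: "dim_row (A_s P) = m * D" "dim_col (A_s P) = n * D" "dim_row (C_s P) = m" "dim_col (C_s P) = n * D"
    "dim_row (B_s P) = m * D" "dim_col (B_s P) = n"
    using arg_cong[OF B_s, of dim_row] arg_cong[OF B_s, of dim_col] by (auto simp: A_s C_s)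
  have D_s: "D_s P \<in> carrier_mat m n"
    by (intro carrier_matI) (simp_all add: D_s_eq)
  \<comment> \<open>As right multiples of \<open>T\<close>, \<open>?S\<close> and \<open>?E\<close>
    are annihilated by \<open>?W1\<close>; as left multiples of \<open>T\<close>, \<open>?S\<close>
    and \<open>?F\<close> are annihilated by \<open>V1\<close>. With the constant terms, both
    coefficients of each outer pencil vanish.\<close>
  have ST: "?S = T * block_shift n D" and ET: "?E = T * block_last n D"
    and TS: "?S = transpose_mat (block_shift m D) * T" and TF: "?F = transpose_mat (block_last m D) * T"
    using hankel_mat_mult_block_shift[OF deg(1)] hankel_mat_mult_block_last[OF deg(2), of P]
      block_shift_mult_hankel_mat[OF deg(1)] block_last_mult_hankel_mat[OF deg(2), of P]
    by (simp_all add: T)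
  have W1S: "?W1 * ?S = 0\<^sub>m a (n * D)"
    unfolding ST by (subst mult_mat_assoc[symmetric]) (simp_all add: W1T)
  have W1E: "?W1 * ?E = 0\<^sub>m a n"
    unfolding ET by (subst mult_mat_assoc[symmetric]) (simp_all add: W1T)
  have SV1: "?S * V1 = 0\<^sub>m (m * D) b"
    unfolding TS by (subst mult_mat_assoc) (simp_all add: TV1)
  have FV1: "?F * V1 = 0\<^sub>m m b"
    unfolding TF by (subst mult_mat_assoc) (simp_all add: TV1)
  have pz: "pencil (0\<^sub>m k l) (0\<^sub>m k l) = 0\<^sub>m k l" for k l
    by (intro eq_matI) auto
  have W1A: "const_pmat ?W1 * A_s P = 0\<^sub>m a (n * D)"
  proof -
    have "?W1 * (- T) = 0\<^sub>m a (n * D)"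
      using W1T uminus_mult_right_mat[of ?W1 T] by (simp add: zero_mat_uminus)
    then show ?thesis by (simp add: A_s const_pmat_mult_pencil W1S pz)
  qed
  have W1B: "const_pmat ?W1 * (- B_s P) = 0\<^sub>m a n"
    by (simp add: B_s const_pmat_mult_pencil W1E pz)
  have AV1: "A_s P * const_pmat V1 = 0\<^sub>m (m * D) b"
  proof -
    have "(- T) * V1 = 0\<^sub>m (m * D) b"
      using TV1 uminus_mult_left_mat[of T V1] by (simp add: zero_mat_uminus)
    then show ?thesis by (simp add: A_s pencil_mult_const_pmat SV1 pz)
  qed
  have CV1: "C_s P * const_pmat V1 = 0\<^sub>m m b"
    by (simp add: C_s pencil_mult_const_pmat FV1 pz)
  have A_form: "const_pmat (mat_adjoint U) * A_s P * const_pmat V =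
    four_block_mat (0\<^sub>m a b) (0\<^sub>m a r) (0\<^sub>m r b) Ah"
  proof -
    have "const_pmat (mat_adjoint U) * A_s P * const_pmat V =
        four_block_mat (const_pmat ?W1 * A_s P * const_pmat V1) (const_pmat ?W1 * A_s P * const_pmat V2)
          (const_pmat ?W2 * A_s P * const_pmat V1) Ah"
      unfolding adjU assms(11) Ah_def
      by (subst const_pmat_append_rows, simp, subst const_pmat_append_cols, simp,
        rule append_rows_mult_mult_append_cols) simp_all
    also have "const_pmat ?W2 * A_s P * const_pmat V1 = 0\<^sub>m r b"
      by (simp add: mult_mat_assoc AV1)
    finally show ?thesis by (simp add: W1A)
  qed
  have B_form: "- (const_pmat (mat_adjoint U) * B_s P) = 0\<^sub>m a n @\<^sub>r (- Bh)"
  proof -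
    have "- (const_pmat (mat_adjoint U) * B_s P) = const_pmat (mat_adjoint U) * (- B_s P)"
      unfolding adjU by simp
    also have "\<dots> = const_pmat ?W1 * (- B_s P) @\<^sub>r const_pmat ?W2 * (- B_s P)"
      unfolding adjU by (subst const_pmat_append_rows, simp, rule append_rows_mult) simp_all
    finally show ?thesis
      unfolding W1B by (simp add: Bh_def)
  qed
  have C_form: "C_s P * const_pmat V = 0\<^sub>m m b @\<^sub>c Ch"
    unfolding assms(11) by (simp add: const_pmat_append_cols mult_append_cols CV1 Ch_def)
  have "diag2 (const_pmat (mat_adjoint U)) (1\<^sub>m m) * L_s P * diag2 (const_pmat V) (1\<^sub>m n) =
      four_block_mat (const_pmat (mat_adjoint U) * A_s P * const_pmat V)
        (const_pmat (mat_adjoint U) * (- B_s P)) (C_s P * const_pmat V) (D_s P)"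
    unfolding L_s_def by (rule diag2_four_block_mult[of _ "m * D" "m * D" _ "n * D" "n * D"])
      (use Uc Vc D_s in \<open>auto intro!: carrier_matI\<close>)
  moreover have "const_pmat (mat_adjoint U) * (- B_s P) = - (const_pmat (mat_adjoint U) * B_s P)"
    using Uc by simp
  ultimately have 1: "diag2 (const_pmat (mat_adjoint U)) (1\<^sub>m m) * L_s P * diag2 (const_pmat V) (1\<^sub>m n) =
      four_block_mat (const_pmat (mat_adjoint U) * A_s P * const_pmat V)
        (- (const_pmat (mat_adjoint U) * B_s P)) (C_s P * const_pmat V) (D_s P)"
    by (simp only:)
  have tf: "rmat P = rmat (D_s P) + rmat Ch * the (mat_inverse (rmat Ah)) * rmat Bh"
    using sml unfolding strongly_minimal_linearization_def transfer_function_def by (elim conjE) (rule sym)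
  have carrier: "Ah \<in> carrier_mat r r" "Bh \<in> carrier_mat r n" "Ch \<in> carrier_mat m r"
    unfolding Ah_def Bh_def Ch_def by (rule carrier_matI; simp)+
  have "four_block_mat (const_pmat (mat_adjoint U) * A_s P * const_pmat V)
      (- (const_pmat (mat_adjoint U) * B_s P)) (C_s P * const_pmat V) (D_s P) =
    four_block_mat (four_block_mat (0\<^sub>m a b) (0\<^sub>m a r) (0\<^sub>m r b) Ah) (0\<^sub>m a n @\<^sub>r (- Bh)) (0\<^sub>m m b @\<^sub>c Ch) (D_s P)"
    unfolding A_form B_form C_form ..
  \<comment> \<open>The witness for \<open>Dh\<close> is \<open>D_s P\<close>, since the outer
    factors act as identities on the lower right block.\<close>
  with 1 carrier D_s sml reg tf show ?thesis
    unfolding D_def[symmetric] a_def[symmetric] b_def[symmetric] by blast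
qed

end
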